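(* Let $\Gamma$ be a connected cubic girth-regular graph of girth $5$. Then either the signature of $\Gamma$ is $(0,1,1)$ and $\Gamma\cong\mathrm{Tr}(\Lambda,\leftrightarrow)$ for some $5$-regular graph $\Lambda$ (possibly with parallel edges) and some dihedral scheme $\leftrightarrow$ on $\Lambda$, or $\Gamma$ is isomorphic to the Petersen graph or to the dodecahedron graph.
   Context: $\Gamma$ is a finite simple graph; cubic means $3$-regular. For a graph of finite girth $g$, a girth cycle is a cycle of length $g$, and $\epsilon(e)$ is the number of girth cycles containing the edge $e$. The signature of a vertex $v$ with incident edges $e_1,\ldots,e_k$ ordered so that $\epsilon(e_1)\le\cdots\le\epsilon(e_k)$ is $(\epsilon(e_1),\ldots,\epsilon(e_k))$; a graph is girth-regular if all vertices have the same signature (the signature of the graph). A graph with parallel edges and loops is $(V,E,\partial)$ with $\partial:E\to\{X\subseteq V:|X|\le2\}$; each edge consists of two mutually inverse arcs with tails; $\mathrm{out}(u)$ is the set of arcs with tail $u$, and $5$-regular means $|\mathrm{out}(u)|=5$ for all $u$. A dihedral scheme on $\Lambda$ is an irreflexive symmetric relation $\leftrightarrow$ on the arc set such that (arcs, $\leftrightarrow$) is a $2$-regular simple graph whose components are exactly the sets $\mathrm{out}(u)$. $\mathrm{Tr}(\Lambda,\leftrightarrow)$ is the simple graph on the arcs of $\Lambda$ with $s,t$ adjacent iff $s\leftrightarrow t$ or $s,t$ are mutually inverse. *)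

theory Defs
  imports "HOL-Library.Multiset" "HOL-Library.Extended_Nat"
begin

section \<open>Simple graphs\<close>

record 'a sgraph =
  verts :: "'a set"
  edges :: "'a set set"

definition simple_graph :: "'a sgraph \<Rightarrow> bool" where
  "simple_graph G \<longleftrightarrow>
     finite (verts G) \<and> (\<forall>e \<in> edges G. e \<subseteq> verts G \<and> card e = 2)"

definition adjacent :: "'a sgraph \<Rightarrow> 'a \<Rightarrow> 'a \<Rightarrow> bool" where
  "adjacent G u v \<longleftrightarrow> {u, v} \<in> edges G"

definition incident_edges :: "'a sgraph \<Rightarrow> 'a \<Rightarrow> 'a set set" where
  "incident_edges G v = {e \<in> edges G. v \<in> e}"

definition regular_graph :: "nat \<Rightarrow> 'a sgraph \<Rightarrow> bool" where
  "regular_graph k G \<longleftrightarrow> (\<forall>v \<in> verts G. card (incident_edges G v) = k)"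

definition component_of :: "'a sgraph \<Rightarrow> 'a \<Rightarrow> 'a set" where
  "component_of G v = {w \<in> verts G. (adjacent G)\<^sup>*\<^sup>* v w}"

definition components :: "'a sgraph \<Rightarrow> 'a set set" where
  "components G = component_of G ` verts G"

definition connected_graph :: "'a sgraph \<Rightarrow> bool" where
  "connected_graph G \<longleftrightarrow>
     verts G \<noteq> {} \<and> (\<forall>u \<in> verts G. \<forall>v \<in> verts G. (adjacent G)\<^sup>*\<^sup>* u v)"

definition isomorphic :: "'a sgraph \<Rightarrow> 'b sgraph \<Rightarrow> bool" (infix "\<cong>\<^sub>G" 50) where
  "G \<cong>\<^sub>G H \<longleftrightarrow>
     (\<exists>f. bij_betw f (verts G) (verts H) \<and>
          (\<forall>u \<in> verts G. \<forall>v \<in> verts G. adjacent G u v \<longleftrightarrow> adjacent H (f u) (f v)))"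


section \<open>Girth and signatures\<close>

text \<open>
  A cycle is identified with its set of edges, so that the different cyclic vertex
  sequences (rotations and reversals) of one cycle are counted once. As the sequence
  has at least three vertices, the length of the cycle is the cardinality of that set.
\<close>

definition cyclic_edges :: "'a list \<Rightarrow> 'a set set" where
  "cyclic_edges vs = {{vs ! i, vs ! (Suc i mod length vs)} | i. i < length vs}"

definition cycles :: "'a sgraph \<Rightarrow> 'a set set set" where
  "cycles G =
     {cyclic_edges vs | vs.
        3 \<le> length vs \<and> distinct vs \<and> set vs \<subseteq> verts G \<and> cyclic_edges vs \<subseteq> edges G}"

definition girth :: "'a sgraph \<Rightarrow> enat" where
  "girth G = (INF C \<in> cycles G. enat (card C))"

definition girth_cycles :: "'a sgraph \<Rightarrow> 'a set set set" where
  "girth_cycles G = {C \<in> cycles G. enat (card C) = girth G}"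

definition girth_cycle_count :: "'a sgraph \<Rightarrow> 'a set \<Rightarrow> nat" where
  "girth_cycle_count G e = card {C \<in> girth_cycles G. e \<in> C}"

definition signature :: "'a sgraph \<Rightarrow> 'a \<Rightarrow> nat list" where
  "signature G v =
     sorted_list_of_multiset
       (image_mset (girth_cycle_count G) (mset_set (incident_edges G v)))"

definition has_signature :: "'a sgraph \<Rightarrow> nat list \<Rightarrow> bool" where
  "has_signature G s \<longleftrightarrow> girth G \<noteq> \<infinity> \<and> (\<forall>v \<in> verts G. signature G v = s)"

definition girth_regular :: "'a sgraph \<Rightarrow> bool" where
  "girth_regular G \<longleftrightarrow> (\<exists>s. has_signature G s)"


section \<open>The Petersen graph and the dodecahedron graph\<close>

definition petersen_graph :: "nat set sgraph" where
  "petersen_graph =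
     \<lparr> verts = {A. A \<subseteq> {..<5} \<and> card A = 2},
       edges = {{A, B} | A B. A \<subseteq> {..<5} \<and> card A = 2 \<and> B \<subseteq> {..<5} \<and> card B = 2
                              \<and> A \<inter> B = {}} \<rparr>"

text \<open>
  The vertices \<open>(False, i)\<close> form the belt of ten vertices between
  two opposite faces of the dodecahedron; the vertices \<open>(True, i)\<close> with \<open>i\<close> even, resp. odd,
  are those of the top, resp. bottom, pentagonal face, and \<open>(True, i)\<close> is joined to
  \<open>(False, i)\<close>. This is the generalized Petersen graph with parameters 10 and 2.
\<close>

definition dodecahedron_graph :: "(bool \<times> nat) sgraph" where
  "dodecahedron_graph =
     \<lparr> verts = UNIV \<times> {..<10},
       edges = {{(False, i), (False, (i + 1) mod 10)} | i. i < 10}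
             \<union> {{(False, i), (True, i)} | i. i < 10}
             \<union> {{(True, i), (True, (i + 2) mod 10)} | i. i < 10} \<rparr>"


section \<open>Graphs with parallel edges and loops\<close>

record ('v, 'e) multigraph =
  mverts :: "'v set"
  medges :: "'e set"
  ends :: "'e \<Rightarrow> 'v set"

definition wf_multigraph :: "('v, 'e) multigraph \<Rightarrow> bool" where
  "wf_multigraph L \<longleftrightarrow>
     finite (mverts L) \<and> finite (medges L) \<and>
     (\<forall>e \<in> medges L. ends L e \<subseteq> mverts L \<and> ends L e \<noteq> {} \<and> card (ends L e) \<le> 2)"

definition is_loop :: "('v, 'e) multigraph \<Rightarrow> 'e \<Rightarrow> bool" where
  "is_loop L e \<longleftrightarrow> card (ends L e) = 1"

definition loopless :: "('v, 'e) multigraph \<Rightarrow> bool" where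
  "loopless L \<longleftrightarrow> (\<forall>e \<in> medges L. \<not> is_loop L e)"

text \<open>
  An arc carries its underlying edge and its tail; the Boolean tag only serves to
  distinguish the two arcs of a loop, and is \<open>False\<close> for every arc of a non-loop.
  As every edge consists of exactly two arcs, the inverse of an arc is the other arc
  with the same underlying edge.
\<close>

datatype ('v, 'e) arc = Arc (arc_edge: 'e) (tail: 'v) (arc_tag: bool)

definition arcs :: "('v, 'e) multigraph \<Rightarrow> ('v, 'e) arc set" where
  "arcs L = {s. arc_edge s \<in> medges L \<and> tail s \<in> ends L (arc_edge s) \<and>
                (arc_tag s \<longrightarrow> is_loop L (arc_edge s))}"

definition mutually_inverse ::
    "('v, 'e) multigraph \<Rightarrow> ('v, 'e) arc \<Rightarrow> ('v, 'e) arc \<Rightarrow> bool" where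
  "mutually_inverse L s t \<longleftrightarrow>
     s \<in> arcs L \<and> t \<in> arcs L \<and> arc_edge s = arc_edge t \<and> s \<noteq> t"

definition out_arcs :: "('v, 'e) multigraph \<Rightarrow> 'v \<Rightarrow> ('v, 'e) arc set" where
  "out_arcs L u = {s \<in> arcs L. tail s = u}"

definition regular_multigraph :: "nat \<Rightarrow> ('v, 'e) multigraph \<Rightarrow> bool" where
  "regular_multigraph k L \<longleftrightarrow> (\<forall>u \<in> mverts L. card (out_arcs L u) = k)"

lemma two_arcs_of_edge:
  assumes "wf_multigraph L" "e \<in> medges L"
  shows "\<exists>s t. s \<noteq> t \<and> {r \<in> arcs L. arc_edge r = e} = {s, t} \<and> ends L e = {tail s, tail t}"
proof -
  have fin: "finite (ends L e)" and ne: "ends L e \<noteq> {}" and le: "card (ends L e) \<le> 2"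
    using assms finite_subset by (auto simp: wf_multigraph_def)
  have "card (ends L e) \<noteq> 0" using fin ne by simp
  with le consider "card (ends L e) = 1" | "card (ends L e) = 2" by linarith
  then show ?thesis
  proof cases
    case 1
    then obtain v where v: "ends L e = {v}" by (auto simp: card_1_singleton_iff)
    have "{r \<in> arcs L. arc_edge r = e} = {Arc e v False, Arc e v True}"
    proof (intro set_eqI iffI)
      fix r assume "r \<in> {r \<in> arcs L. arc_edge r = e}"
      then show "r \<in> {Arc e v False, Arc e v True}"
        using v by (cases r) (auto simp: arcs_def)
    qed (use assms 1 v in \<open>auto simp: arcs_def is_loop_def\<close>)
    then show ?thesis
      using v by (intro exI[of _ "Arc e v False"] exI[of _ "Arc e v True"]) simp
  next
    case 2
    then obtain u v where uv: "ends L e = {u, v}" "u \<noteq> v" by (auto simp: card_2_iff)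
    have "{r \<in> arcs L. arc_edge r = e} = {Arc e u False, Arc e v False}"
    proof (intro set_eqI iffI)
      fix r assume "r \<in> {r \<in> arcs L. arc_edge r = e}"
      then show "r \<in> {Arc e u False, Arc e v False}"
        using uv 2 by (cases r) (auto simp: arcs_def is_loop_def)
    qed (use assms uv in \<open>auto simp: arcs_def\<close>)
    then show ?thesis
      using uv by (intro exI[of _ "Arc e u False"] exI[of _ "Arc e v False"]) simp
  qed
qed


section \<open>Dihedral schemes and truncations\<close>

definition scheme_graph ::
    "('v, 'e) multigraph \<Rightarrow> (('v, 'e) arc \<Rightarrow> ('v, 'e) arc \<Rightarrow> bool) \<Rightarrow> ('v, 'e) arc sgraph" where
  "scheme_graph L R = \<lparr> verts = arcs L, edges = {{s, t} | s t. R s t} \<rparr>"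

definition dihedral_scheme ::
    "('v, 'e) multigraph \<Rightarrow> (('v, 'e) arc \<Rightarrow> ('v, 'e) arc \<Rightarrow> bool) \<Rightarrow> bool" where
  "dihedral_scheme L R \<longleftrightarrow>
     (\<forall>s t. R s t \<longrightarrow> s \<in> arcs L \<and> t \<in> arcs L) \<and> irreflp R \<and> symp R \<and>
     regular_graph 2 (scheme_graph L R) \<and>
     components (scheme_graph L R) = out_arcs L ` mverts L"

definition Tr ::
    "('v, 'e) multigraph \<Rightarrow> (('v, 'e) arc \<Rightarrow> ('v, 'e) arc \<Rightarrow> bool) \<Rightarrow> ('v, 'e) arc sgraph" where
  "Tr L R =
     \<lparr> verts = arcs L,
       edges = {{s, t} | s t. R s t \<or> mutually_inverse L s t} \<rparr>"

end

theory Submission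
  imports Defs "HOL-Library.Numeral_Type"
begin

text \<open>
  By girth 5, a 2-path lies on at most two 5-cycles, and the signature of a vertex determines the
  multiset of the numbers of 5-cycles through the three 2-paths centred at it. If one
  number occurs there exactly once, then the edges opposite to the corresponding 2-paths form a perfect
  matching, because they are singled out by their number of girth cycles. In the case
  \<open>{0, 0, 1}\<close> the complement of the matching consists of disjoint 5-cycles, and contracting
  them gives the 5-regular multigraph. In the cases \<open>{0, i, j}\<close> with \<open>i, j > 0\<close> matching edges would
  alternate along a 5-cycle; \<open>{0, 0, 2}\<close>, \<open>{1, 1, 2}\<close> and \<open>{1, 2, 2}\<close> are refuted locally. For
  \<open>{2, 2, 2}\<close> the ball of radius 2 closes up to the Petersen graph, and for \<open>{1, 1, 1}\<close> the unique
  5-cycles through the 2-paths are the faces of a dodecahedron.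
\<close>

section \<open>Counting 5-cycles through 2-paths\<close>

text \<open>2-paths are counted instead of edges because their counts are local: the 5-cycles
  through a 2-path correspond to the edges between the outer neighbours of its two ends. If the
  three counts at a vertex have sum \<open>S\<close>, the edge opposite to a 2-path with count
  \<open>t\<close> lies on \<open>S - t\<close> girth cycles. An edge is counted alike from both of
  its ends, so this carries information from a vertex to its neighbours. The obstacle is that
  girth-regularity fixes the three counts only as a multiset and does not say which 2-path carries
  which count. A non-constant multiset of size three has an element of multiplicity one, and that
  element restores a coherent labelling; constant multisets need none. The counts are at most 2, so
  ten multisets remain, three of which contain \<open>0\<close> exactly once; for these it is
  decisive that 5 is odd.\<close>

lemma cyclic_edges_eq_image:
  "cyclic_edges vs = (\<lambda>i. {vs ! i, vs ! (Suc i mod length vs)}) ` {..<length vs}"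
  by (auto simp: cyclic_edges_def)

text \<open>Two different positions yield the same edge only if each is the cyclic successor of the
  other, and then the length divides 2.\<close>

lemma card_cyclic_edges:
  assumes "distinct vs" "3 \<le> length vs"
  shows "card (cyclic_edges vs) = length vs"
proof -
  let ?n = "length vs"
  have "i = j"
    if i: "i < ?n" and j: "j < ?n"
      and eq: "{vs ! i, vs ! (Suc i mod ?n)} = {vs ! j, vs ! (Suc j mod ?n)}" for i j
  proof (rule ccontr)
    assume "i \<noteq> j"
    then have "vs ! i \<noteq> vs ! j" using i j assms(1) by (simp add: nth_eq_iff_index_eq)
    then have "vs ! i = vs ! (Suc j mod ?n)" "vs ! (Suc i mod ?n) = vs ! j"
      using eq unfolding doubleton_eq_iff by blast+
    moreover have "Suc i mod ?n < ?n" "Suc j mod ?n < ?n"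
      using assms(2) by (auto intro!: mod_less_divisor)
    ultimately have "i = Suc j mod ?n" "Suc i mod ?n = j"
      using assms(1) i j nth_eq_iff_index_eq by blast+
    then show False using i j assms(2) by (auto simp: mod_Suc split: if_splits)
  qed
  then have "inj_on (\<lambda>i. {vs ! i, vs ! (Suc i mod ?n)}) {..<?n}"
    by (intro inj_onI) simp
  then show ?thesis by (simp add: cyclic_edges_eq_image card_image)
qed

definition pent_edges :: "'a \<Rightarrow> 'a \<Rightarrow> 'a \<Rightarrow> 'a \<Rightarrow> 'a \<Rightarrow> 'a set set" where
  "pent_edges a b c d e = {{a, b}, {b, c}, {c, d}, {d, e}, {e, a}}"

lemma cyclic_edges_5: "cyclic_edges [a, b, c, d, e] = pent_edges a b c d e"
  by (auto simp: cyclic_edges_eq_image pent_edges_def lessThan_Suc)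

lemma pent_edges_rotate: "pent_edges a b c d e = pent_edges b c d e a"
  by (auto simp: pent_edges_def)

lemma pent_edges_reflect: "pent_edges a b c d e = pent_edges b a e d c"
  by (auto simp: pent_edges_def insert_commute)

section \<open>Short cycles and neighbourhoods in a cubic graph of girth 5\<close>

locale cubic_girth5 =
  fixes G :: "'a sgraph"
  assumes simple: "simple_graph G"
    and cubic: "regular_graph 3 G"
    and girth5: "girth G = 5"
begin

abbreviation adj :: "'a \<Rightarrow> 'a \<Rightarrow> bool" where "adj \<equiv> adjacent G"

lemma adj_sym: "adj u v \<Longrightarrow> adj v u"
  by (simp add: adjacent_def insert_commute)

lemma adj_irrefl [simp]: "\<not> adj u u"
  using simple by (auto simp: adjacent_def simple_graph_def)

lemma adj_verts: "adj u v \<Longrightarrow> u \<in> verts G" "adj u v \<Longrightarrow> v \<in> verts G"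
  using simple by (auto simp: adjacent_def simple_graph_def)

lemma cycle_card_ge: "C \<in> cycles G \<Longrightarrow> 5 \<le> card C"
proof -
  assume "C \<in> cycles G"
  then have "girth G \<le> enat (card C)" unfolding girth_def by (rule INF_lower)
  then show ?thesis using girth5 by (simp add: numeral_eq_enat)
qed

lemma no_triangle: "adj a b \<Longrightarrow> adj b c \<Longrightarrow> adj c a \<Longrightarrow> False"
proof -
  assume adj: "adj a b" "adj b c" "adj c a"
  then have "distinct [a, b, c]" by auto
  moreover have "cyclic_edges [a, b, c] \<subseteq> edges G"
    using adj by (auto simp: cyclic_edges_eq_image lessThan_Suc adjacent_def)
  ultimately have "cyclic_edges [a, b, c] \<in> cycles G"
    using adj adj_verts by (auto simp: cycles_def intro!: exI[of _ "[a, b, c]"])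
  from cycle_card_ge[OF this] card_cyclic_edges[OF \<open>distinct [a, b, c]\<close>] show False by simp
qed

lemma no_square:
  "adj a b \<Longrightarrow> adj b c \<Longrightarrow> adj c d \<Longrightarrow> adj d a \<Longrightarrow> a \<noteq> c \<Longrightarrow> b \<noteq> d \<Longrightarrow> False"
proof -
  assume adj: "adj a b" "adj b c" "adj c d" "adj d a" "a \<noteq> c" "b \<noteq> d"
  then have "distinct [a, b, c, d]" by auto
  moreover have "cyclic_edges [a, b, c, d] \<subseteq> edges G"
    using adj by (auto simp: cyclic_edges_eq_image lessThan_Suc adjacent_def)
  ultimately have "cyclic_edges [a, b, c, d] \<in> cycles G"
    using adj adj_verts by (auto simp: cycles_def intro!: exI[of _ "[a, b, c, d]"])
  from cycle_card_ge[OF this] card_cyclic_edges[OF \<open>distinct [a, b, c, d]\<close>] show False by simp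
qed

lemma unique_common_neighbour:
  "adj a b \<Longrightarrow> adj c b \<Longrightarrow> adj a d \<Longrightarrow> adj c d \<Longrightarrow> a \<noteq> c \<Longrightarrow> b = d"
  using no_square adj_sym by blast

text \<open>A closed walk of length 5 has distinct vertices because there are no triangles.\<close>

definition pentagon :: "'a \<Rightarrow> 'a \<Rightarrow> 'a \<Rightarrow> 'a \<Rightarrow> 'a \<Rightarrow> bool" where
  "pentagon a b c d e \<longleftrightarrow> adj a b \<and> adj b c \<and> adj c d \<and> adj d e \<and> adj e a"

lemma pentagon_distinct: "pentagon a b c d e \<Longrightarrow> distinct [a, b, c, d, e]"
proof -
  assume "pentagon a b c d e"
  then have h: "adj a b" "adj b c" "adj c d" "adj d e" "adj e a" by (auto simp: pentagon_def)
  have "a \<noteq> b" "b \<noteq> c" "c \<noteq> d" "d \<noteq> e" "e \<noteq> a" using h by auto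
  moreover have "a \<noteq> c" "a \<noteq> d" "b \<noteq> d" "b \<noteq> e" "c \<noteq> e" using h no_triangle by blast+
  ultimately show ?thesis by simp
qed

lemma pentagon_rotate: "pentagon a b c d e \<Longrightarrow> pentagon b c d e a"
  by (auto simp: pentagon_def)

lemma pentagon_reflect: "pentagon a b c d e \<Longrightarrow> pentagon b a e d c"
  unfolding pentagon_def using adj_sym by blast

lemma girth_cycles_eq:
  "girth_cycles G = {pent_edges a b c d e | a b c d e. pentagon a b c d e}"
proof (intro set_eqI iffI)
  fix C assume "C \<in> girth_cycles G"
  then obtain vs where vs: "C = cyclic_edges vs" "3 \<le> length vs" "distinct vs"
      "cyclic_edges vs \<subseteq> edges G" "card C = 5"
    using girth5 by (auto simp: girth_cycles_def cycles_def numeral_eq_enat)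
  then have "length vs = 5" using card_cyclic_edges by metis
  then obtain a b c d e where "vs = [a, b, c, d, e]"
    by (auto simp: length_Suc_conv numeral_eq_Suc)
  with vs have "C = pent_edges a b c d e" "pent_edges a b c d e \<subseteq> edges G"
    by (simp_all add: cyclic_edges_5)
  moreover from this have "pentagon a b c d e"
    by (simp add: pentagon_def adjacent_def pent_edges_def)
  ultimately show "C \<in> {pent_edges a b c d e | a b c d e. pentagon a b c d e}" by blast
next
  fix C assume "C \<in> {pent_edges a b c d e | a b c d e. pentagon a b c d e}"
  then obtain a b c d e where C: "C = pent_edges a b c d e" and q: "pentagon a b c d e" by blast
  let ?vs = "[a, b, c, d, e]"
  have d: "distinct ?vs" using pentagon_distinct[OF q] .
  have "C = cyclic_edges ?vs" using C by (simp add: cyclic_edges_5)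
  moreover have "set ?vs \<subseteq> verts G" using q adj_verts unfolding pentagon_def by auto
  moreover have "cyclic_edges ?vs \<subseteq> edges G"
    using q unfolding pentagon_def cyclic_edges_5 pent_edges_def adjacent_def by auto
  ultimately have "C \<in> cycles G" using d unfolding cycles_def by force
  moreover have "card C = 5" using card_cyclic_edges[OF d] C by (simp add: cyclic_edges_5)
  ultimately show "C \<in> girth_cycles G" using girth5
    by (simp add: girth_cycles_def numeral_eq_enat)
qed

text \<open>Finite girth means that there is a cycle, and an infimum over a nonempty set is attained
  in a well-order.\<close>

lemma ex_pentagon: "\<exists>a b c d e. pentagon a b c d e"
proof -
  have "cycles G \<noteq> {}" using girth5 by (auto simp: girth_def top_enat_def)
  then obtain C0 where "C0 \<in> cycles G" by blast
  then have "girth G \<in> (\<lambda>C. enat (card C)) ` cycles G"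
    unfolding girth_def by (intro wellorder_InfI) auto
  then have "girth_cycles G \<noteq> {}" by (auto simp: girth_cycles_def)
  then show ?thesis by (auto simp: girth_cycles_eq)
qed

text \<open>The neighbours are listed in order so that one of them, such as the middle of a 2-path
  or a mate in a matching, can be set apart from the other two.\<close>

definition nb :: "'a \<Rightarrow> 'a \<Rightarrow> 'a \<Rightarrow> 'a \<Rightarrow> bool" where
  "nb v x y z \<longleftrightarrow> {u. adj v u} = {x, y, z} \<and> distinct [x, y, z]"

lemma nb_adj_iff: "nb v x y z \<Longrightarrow> adj v u \<longleftrightarrow> u = x \<or> u = y \<or> u = z"
  by (auto simp: nb_def)

lemma nb_adj: "nb v x y z \<Longrightarrow> adj v x" "nb v x y z \<Longrightarrow> adj v y" "nb v x y z \<Longrightarrow> adj v z"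
  by (auto simp: nb_adj_iff)

lemma nb_distinct: "nb v x y z \<Longrightarrow> x \<noteq> y \<and> x \<noteq> z \<and> y \<noteq> z"
  by (auto simp: nb_def)

lemma nb_swap: "nb v x y z \<Longrightarrow> nb v x z y"
  by (auto simp: nb_def)

lemma nb_rotate: "nb v x y z \<Longrightarrow> nb v y z x"
  by (auto simp: nb_def)

lemma nb_verts: "nb v x y z \<Longrightarrow> v \<in> verts G"
  using nb_adj adj_verts by blast

lemma incident_edges_eq: "incident_edges G v = (\<lambda>u. {v, u}) ` {u. adj v u}"
proof -
  have "e \<in> (\<lambda>u. {v, u}) ` {u. adj v u}" if "e \<in> edges G" "v \<in> e" for e
  proof -
    have "card e = 2" using that simple by (auto simp: simple_graph_def)
    then obtain x y where "e = {x, y}" by (auto simp: card_2_iff)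
    then show ?thesis using that by (auto simp: adjacent_def insert_commute)
  qed
  then show ?thesis by (auto simp: incident_edges_def adjacent_def)
qed

lemma ex_nb: "v \<in> verts G \<Longrightarrow> \<exists>x y z. nb v x y z"
proof -
  assume "v \<in> verts G"
  then have "card (incident_edges G v) = 3" using cubic by (simp add: regular_graph_def)
  moreover have "inj_on (\<lambda>u. {v, u}) {u. adj v u}"
    by (auto simp: inj_on_def doubleton_eq_iff)
  ultimately have "card {u. adj v u} = 3"
    by (simp add: incident_edges_eq card_image)
  then show ?thesis unfolding nb_def
    by (auto simp: card_Suc_eq numeral_eq_Suc)
qed

lemma ex_nb1: "adj v x \<Longrightarrow> \<exists>y z. nb v x y z"
proof -
  assume x: "adj v x"
  then obtain a b c where n: "nb v a b c" using ex_nb adj_verts by blast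
  then show ?thesis using nb_adj_iff[OF n, of x] x nb_rotate by blast
qed

lemma ex_nb2: "adj v x \<Longrightarrow> adj v y \<Longrightarrow> x \<noteq> y \<Longrightarrow> \<exists>z. nb v x y z"
  using ex_nb1 nb_adj_iff nb_swap by metis

text \<open>
  The number of 5-cycles through the 2-path \<open>a, b, c\<close>; the pairs \<open>(x, y)\<close> complete it to the
  closed walk \<open>x, a, b, c, y\<close>.
\<close>

definition npent :: "'a \<Rightarrow> 'a \<Rightarrow> 'a \<Rightarrow> nat" where
  "npent a b c = card {(x, y). adj a x \<and> x \<noteq> b \<and> adj c y \<and> y \<noteq> b \<and> adj x y}"

text \<open>Turns a count into four adjacency tests between outer neighbours, the form in which the
  local contradictions below are read off.\<close>

lemma npent_eq:
  assumes a: "nb a b a1 a2" and c: "nb c b c1 c2"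
  shows "npent a b c = of_bool (adj a1 c1) + of_bool (adj a1 c2) + of_bool (adj a2 c1) + of_bool (adj a2 c2)"
proof -
  let ?A = "{(a1, c1), (a1, c2), (a2, c1), (a2, c2)}"
  have "{(x, y). adj a x \<and> x \<noteq> b \<and> adj c y \<and> y \<noteq> b \<and> adj x y} =
      ?A \<inter> {q. adj (fst q) (snd q)}"
    using nb_distinct[OF a] nb_distinct[OF c] by (auto simp: nb_adj_iff[OF a] nb_adj_iff[OF c])
  then have "npent a b c = (\<Sum>q\<in>?A. of_bool (adj (fst q) (snd q)))"
    using sum_of_bool_eq[of ?A "\<lambda>q. adj (fst q) (snd q)", where ?'a = nat] by (simp add: npent_def)
  then show ?thesis using nb_distinct[OF a] nb_distinct[OF c] by simp
qed

lemma npent_commute: "npent a b c = npent c b a"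
proof -
  have "{(x, y). adj a x \<and> x \<noteq> b \<and> adj c y \<and> y \<noteq> b \<and> adj x y} =
     prod.swap ` {(x, y). adj c x \<and> x \<noteq> b \<and> adj a y \<and> y \<noteq> b \<and> adj x y}"
    using adj_sym by (auto simp: image_iff)
  then show ?thesis unfolding npent_def by (metis (no_types, lifting) card_image inj_swap)
qed

text \<open>Two edges between the pairs of outer neighbours that share an end would close a 4-cycle
  through \<open>a\<close> or \<open>c\<close>. The edges therefore form a matching between two sets
  of size 2.\<close>

lemma npent_le_2:
  assumes "adj a b" "adj b c" "a \<noteq> c"
  shows "npent a b c \<le> 2"
proof -
  obtain a1 a2 where a: "nb a b a1 a2" using assms ex_nb1 by blast
  obtain c1 c2 where c: "nb c b c1 c2" using assms ex_nb1 adj_sym by blast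
  have "\<not> (adj a1 c1 \<and> adj a1 c2)" "\<not> (adj a2 c1 \<and> adj a2 c2)"
    "\<not> (adj a1 c1 \<and> adj a2 c1)" "\<not> (adj a1 c2 \<and> adj a2 c2)"
    using nb_adj[OF a] nb_adj[OF c] nb_distinct[OF a] nb_distinct[OF c] assms
      unique_common_neighbour adj_sym no_triangle by metis+
  then show ?thesis by (auto simp: npent_eq[OF a c])
qed

section \<open>Edge counts as sums of 2-path counts\<close>

lemma girth_cycle_through_edge:
  assumes "C \<in> girth_cycles G" "{a, b} \<in> C"
  shows "\<exists>c d e. pentagon a b c d e \<and> C = pent_edges a b c d e"
proof -
  obtain u v w x y where "pentagon u v w x y" "C = pent_edges u v w x y"
    using assms(1) by (auto simp: girth_cycles_eq)
  moreover define Q where "Q a b c d e \<longleftrightarrow> pentagon a b c d e \<and> C = pent_edges a b c d e" for a b c d e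
  ultimately have Q: "Q u v w x y" by simp
  \<comment> \<open>Rotations and the reflection preserve \<open>Q\<close>, so whichever of the five
    edges is \<open>{a, b}\<close> can be moved to the front.\<close>
  have rot: "Q b c d e a" if "Q a b c d e" for a b c d e
    using that pentagon_rotate pent_edges_rotate unfolding Q_def by metis
  have refl: "Q b a e d c" if "Q a b c d e" for a b c d e
    using that pentagon_reflect pent_edges_reflect unfolding Q_def by metis
  have *: "\<exists>c d e. Q a b c d e" if "{a, b} = {a', b'}" "Q a' b' c' d' e'" for a' b' c' d' e'
    using that(1) that(2) refl[OF that(2)] unfolding doubleton_eq_iff by blast
  have "{a, b} \<in> pent_edges u v w x y" using assms(2) Q Q_def by simp
  then consider "{a, b} = {u, v}" | "{a, b} = {v, w}" | "{a, b} = {w, x}" | "{a, b} = {x, y}"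
    | "{a, b} = {y, u}" unfolding pent_edges_def insert_iff empty_iff by metis
  then have "\<exists>c d e. Q a b c d e"
  proof cases
    case 1 then show ?thesis using * Q by blast
  next
    case 2 then show ?thesis using * rot[OF Q] by blast
  next
    case 3 then show ?thesis using * rot[OF rot[OF Q]] by blast
  next
    case 4 then show ?thesis using * rot[OF rot[OF rot[OF Q]]] by blast
  next
    case 5 then show ?thesis using * rot[OF rot[OF rot[OF rot[OF Q]]]] by blast
  qed
  then show ?thesis by (simp add: Q_def)
qed

definition through :: "'a \<Rightarrow> 'a \<Rightarrow> 'a \<Rightarrow> 'a set set set" where
  "through a b c = {C \<in> girth_cycles G. {a, b} \<in> C \<and> {b, c} \<in> C}"

text \<open>Each admissible pair closes the 2-path to a 5-cycle. Conversely, the edges of the cycle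
  at \<open>a\<close> and at \<open>c\<close> give back the two remaining vertices, so pairs and
  edge sets correspond bijectively.\<close>

lemma card_through:
  assumes "adj a b" "adj b c" "a \<noteq> c"
  shows "card (through a b c) = npent a b c" "finite (through a b c)"
proof -
  let ?S = "{(x, y). adj a x \<and> x \<noteq> b \<and> adj c y \<and> y \<noteq> b \<and> adj x y}"
  let ?f = "\<lambda>(x, y). pent_edges a b c y x"
  have pent: "pentagon a b c y x" if "(x, y) \<in> ?S" for x y
    using that assms adj_sym unfolding pentagon_def by blast
  have *: "?f ` ?S \<subseteq> through a b c"
  proof (clarify)
    fix x y assume "adj a x" "x \<noteq> b" "adj c y" "y \<noteq> b" "adj x y"
    then have "pentagon a b c y x" using pent by blast
    then have "pent_edges a b c y x \<in> girth_cycles G" unfolding girth_cycles_eq by blast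
    then show "pent_edges a b c y x \<in> through a b c" by (simp add: through_def pent_edges_def)
  qed
  moreover have "C \<in> ?f ` ?S" if C: "C \<in> through a b c" for C
  proof -
    obtain z y x where q: "pentagon a b z y x" "C = pent_edges a b z y x"
      using C girth_cycle_through_edge unfolding through_def by blast
    have "{b, c} \<in> pent_edges a b z y x" using C q by (simp add: through_def)
    then have "z = c" using pentagon_distinct[OF q(1)] assms
      by (auto simp: pent_edges_def doubleton_eq_iff)
    moreover have "(x, y) \<in> ?S" using q(1) pentagon_distinct[OF q(1)] \<open>z = c\<close>
      unfolding pentagon_def by (auto intro: adj_sym)
    ultimately show ?thesis using q by blast
  qed
  ultimately have eq: "through a b c = ?f ` ?S" by blast
  have "inj_on ?f ?S"
  proof (rule inj_onI)
    fix q r assume q: "q \<in> ?S" and r: "r \<in> ?S" and e: "?f q = ?f r"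
    obtain x y x' y' where xy: "q = (x, y)" "r = (x', y')" by (cases q, cases r) auto
    have d: "distinct [a, b, c, y, x]" "distinct [a, b, c, y', x']"
      using pent[of x y] pent[of x' y'] q r unfolding xy by (blast intro: pentagon_distinct)+
    have e': "pent_edges a b c y x = pent_edges a b c y' x'" using e xy by simp
    have "{x', a} \<in> pent_edges a b c y x" "{c, y'} \<in> pent_edges a b c y x"
      unfolding e' by (auto simp: pent_edges_def)
    then show "q = r" using d xy by (auto simp: pent_edges_def doubleton_eq_iff)
  qed
  then show "card (through a b c) = npent a b c" by (simp add: eq npent_def card_image)
  have "?S \<subseteq> verts G \<times> verts G" using adj_verts by auto
  then have "finite ?S" using simple finite_subset unfolding simple_graph_def by blast
  then show "finite (through a b c)" by (simp add: eq)
qed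

text \<open>A cycle through the edge leaves \<open>v\<close> along exactly one of the two other
  edges.\<close>

lemma girth_cycle_count_eq:
  assumes n: "nb v x y z"
  shows "girth_cycle_count G {v, x} = npent x v y + npent x v z"
proof -
  have "C \<in> through x v y \<union> through x v z" if C: "C \<in> girth_cycles G" "{v, x} \<in> C" for C
  proof -
    obtain c d e where q: "pentagon x v c d e" "C = pent_edges x v c d e"
      using C girth_cycle_through_edge by (metis insert_commute)
    then have "c = y \<or> c = z"
      using nb_adj_iff[OF n, of c] pentagon_distinct[OF q(1)] unfolding pentagon_def by auto
    moreover have "C \<in> through x v c" using C q(2) by (simp add: through_def pent_edges_def)
    ultimately show ?thesis by blast
  qed
  then have "{C \<in> girth_cycles G. {v, x} \<in> C} = through x v y \<union> through x v z"
    by (auto simp: through_def insert_commute)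
  moreover have "through x v y \<inter> through x v z = {}"
  proof -
    have False if C: "C \<in> through x v y" "C \<in> through x v z" for C
    proof -
      obtain c d e where q: "pentagon x v c d e" "C = pent_edges x v c d e"
        using C girth_cycle_through_edge unfolding through_def by blast
      have "{v, y} \<in> C" "{v, z} \<in> C" using C by (auto simp: through_def)
      then show False using q pentagon_distinct[OF q(1)] nb_distinct[OF n]
        by (auto simp: pent_edges_def doubleton_eq_iff)
    qed
    then show ?thesis by blast
  qed
  ultimately show ?thesis
    using card_through[of x v y] card_through[of x v z] nb_adj[OF n] nb_distinct[OF n] adj_sym
    by (simp add: girth_cycle_count_def card_Un_disjoint)
qed

text \<open>Both sides count the girth cycles through \<open>{a, b}\<close>, split up at one end and
  at the other; this links the counts at adjacent vertices.\<close>

lemma edge_weight_sym: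
  assumes "nb a b a1 a2" "nb b a b1 b2"
  shows "npent b a a1 + npent b a a2 = npent a b b1 + npent a b b2"
  using girth_cycle_count_eq[OF assms(1)] girth_cycle_count_eq[OF assms(2)]
  by (simp add: insert_commute)

lemma mset_signature:
  assumes n: "nb v x y z"
  shows "mset (signature G v) =
    {#npent x v y + npent x v z, npent x v y + npent y v z, npent x v z + npent y v z#}"
proof -
  have "incident_edges G v = {{v, x}, {v, y}, {v, z}}"
    using n by (auto simp: incident_edges_eq nb_def)
  moreover have "{v, x} \<noteq> {v, y}" "{v, x} \<noteq> {v, z}" "{v, y} \<noteq> {v, z}"
    using nb_distinct[OF n] by (auto simp: doubleton_eq_iff)
  ultimately have "mset (signature G v) =
      {#girth_cycle_count G {v, x}, girth_cycle_count G {v, y}, girth_cycle_count G {v, z}#}"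
    by (simp add: signature_def)
  then show ?thesis
    using girth_cycle_count_eq[OF n] girth_cycle_count_eq[OF nb_rotate[OF n]]
      girth_cycle_count_eq[OF nb_rotate[OF nb_rotate[OF n]]]
      npent_commute[of y v x] npent_commute[of z v x] npent_commute[of z v y]
    by (simp add: add.commute)
qed

section \<open>Reading adjacencies and 5-cycles off the 2-path counts\<close>

lemma nb_others:
  assumes "nb v u x y" "nb v u x' y'"
  shows "x = x' \<and> y = y' \<or> x = y' \<and> y = x'"
  using nb_adj_iff[OF assms(1), of x'] nb_adj_iff[OF assms(1), of y']
    nb_adj[OF assms(2)] nb_distinct[OF assms(2)] by blast

lemma nbI:
  assumes "adj v x" "adj v y" "adj v z" "x \<noteq> y" "x \<noteq> z" "y \<noteq> z"
  shows "nb v x y z"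
proof -
  obtain w where w: "nb v x y w" using ex_nb2 assms by blast
  then show ?thesis using nb_adj_iff[OF w, of z] assms by auto
qed

lemma npent_others: "nb v u x y \<Longrightarrow> nb v u x' y' \<Longrightarrow> npent x v y = npent x' v y'"
  using nb_others npent_commute by metis

text \<open>The edges between the outer neighbours form a matching, and two of them make it
  perfect.\<close>

lemma npent_eq_2:
  assumes a: "nb a b a1 a2" and c: "nb c b c1 c2" and "a \<noteq> c" "npent a b c = 2"
  shows "adj a1 c1 \<and> adj a2 c2 \<or> adj a1 c2 \<and> adj a2 c1"
proof -
  have "\<not> (adj a1 c1 \<and> adj a1 c2)" "\<not> (adj a2 c1 \<and> adj a2 c2)"
    "\<not> (adj a1 c1 \<and> adj a2 c1)" "\<not> (adj a1 c2 \<and> adj a2 c2)"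
    using nb_adj[OF a] nb_adj[OF c] nb_distinct[OF a] nb_distinct[OF c] assms
      unique_common_neighbour adj_sym no_triangle by metis+
  then show ?thesis using assms(4) unfolding npent_eq[OF a c] of_bool_def
    by (simp split: if_splits)
qed

lemma finite_npent_set: "finite {(x, y). adj a x \<and> x \<noteq> b \<and> adj c y \<and> y \<noteq> b \<and> adj x y}"
proof (rule finite_subset)
  show "{(x, y). adj a x \<and> x \<noteq> b \<and> adj c y \<and> y \<noteq> b \<and> adj x y} \<subseteq> verts G \<times> verts G"
    using adj_verts by auto
  show "finite (verts G \<times> verts G)" using simple by (simp add: simple_graph_def)
qed

lemma pentagon_npent_set:
  assumes "pentagon a b c d e"
  shows "(e, d) \<in> {(x, y). adj a x \<and> x \<noteq> b \<and> adj c y \<and> y \<noteq> b \<and> adj x y}"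
proof -
  have "adj a e" "adj c d" "adj e d" using assms adj_sym unfolding pentagon_def by blast+
  then show ?thesis using pentagon_distinct[OF assms] by auto
qed

lemma pentagon_npent: "pentagon a b c d e \<Longrightarrow> npent a b c \<noteq> 0"
  using pentagon_npent_set[of a b c d e] unfolding npent_def card_0_eq[OF finite_npent_set] by blast

lemma unique_pentagon:
  assumes "npent a b c = 1" "pentagon a b c d e" "pentagon a b c d' e'"
  shows "d = d'" "e = e'"
proof -
  obtain q where "{(x, y). adj a x \<and> x \<noteq> b \<and> adj c y \<and> y \<noteq> b \<and> adj x y} = {q}"
    using assms(1) unfolding npent_def by (rule card_1_singletonE)
  then have "(e, d) = q" "(e', d') = q"
    using pentagon_npent_set[OF assms(2)] pentagon_npent_set[OF assms(3)] by simp_all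
  then show "d = d'" "e = e'" by auto
qed

lemma npent_nonzero_pentagon:
  assumes "npent a b c \<noteq> 0" "adj a b" "adj b c"
  shows "\<exists>d e. pentagon a b c d e"
proof -
  have "{(x, y). adj a x \<and> x \<noteq> b \<and> adj c y \<and> y \<noteq> b \<and> adj x y} \<noteq> {}"
    using assms(1) unfolding npent_def by (metis card.empty)
  then show ?thesis using assms(2,3) adj_sym unfolding pentagon_def by blast
qed

text \<open>If the mate were a cycle neighbour of \<open>b\<close>, a 2-path of count 0 would lie on
  a 5-cycle. So the mate is the neighbour of \<open>b\<close> off the cycle.\<close>

lemma pentagon_avoids_mate:
  assumes m: "\<And>v. v \<in> verts G \<Longrightarrow> adj v (m v)"
    "\<And>v x y. nb v (m v) x y \<Longrightarrow> npent (m v) v x = 0 \<and> npent (m v) v y = 0"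
    and q: "pentagon a b c d e"
  shows "nb b (m b) a c"
proof -
  have b: "b \<in> verts G" "adj b a" "adj b c" "a \<noteq> c" using q adj_verts adj_sym pentagon_distinct[OF q]
    unfolding pentagon_def by auto
  have "m b \<noteq> a"
  proof
    assume "m b = a"
    then obtain z where n: "nb b (m b) c z" using b ex_nb2 by blast
    then show False using m(2)[OF n] pentagon_npent[OF q] \<open>m b = a\<close> by simp
  qed
  moreover have "m b \<noteq> c"
  proof
    assume "m b = c"
    then obtain z where n: "nb b (m b) a z" using b ex_nb2 by blast
    then show False using m(2)[OF n] pentagon_npent[OF q] \<open>m b = c\<close> npent_commute by simp
  qed
  moreover obtain z where z: "nb b a c z" using b ex_nb2 by blast
  ultimately have "m b = z" using m(1)[OF b(1)] nb_adj_iff by blast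
  then show ?thesis using z nb_rotate by blast
qed

end

section \<open>Excluded signatures\<close>

text \<open>The parameter \<open>T\<close> is the multiset of the numbers of 5-cycles through the three
  2-paths centred at a vertex; it determines, and is determined by, the signature.\<close>

locale girth_regular_cubic5 = cubic_girth5 +
  fixes T :: "nat multiset"
  assumes connected: "connected_graph G"
    and T: "nb v x y z \<Longrightarrow> {#npent x v y, npent x v z, npent y v z#} = T"
begin

text \<open>The mate of \<open>v\<close> is the neighbour missed by the only 2-path at
  \<open>v\<close> with count \<open>\<alpha>\<close>. The edge to it has weight equal to the sum of
  \<open>T\<close> minus \<open>\<alpha>\<close>; weight and sum are the same at the other end, so
  the count opposite to the edge is \<open>\<alpha>\<close> there too. This makes the relation
  symmetric.\<close>

lemma ex_perfect_matching:
  assumes c1: "count T \<alpha> = 1"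
  shows "\<exists>m. \<forall>v \<in> verts G. m v \<in> verts G \<and> m (m v) = v \<and> adj v (m v) \<and>
    (\<forall>x y. nb v (m v) x y \<longrightarrow> npent x v y = \<alpha> \<and> {#npent (m v) v x, npent (m v) v y#} = T - {#\<alpha>#})"
proof -
  define M where "M v u \<longleftrightarrow> (\<exists>x y. nb v u x y \<and> npent x v y = \<alpha>)" for v u
  have ex: "\<exists>u. M v u" if v: "v \<in> verts G" for v
  proof -
    obtain x y z where n: "nb v x y z" using ex_nb v by blast
    have "\<alpha> \<in># T" using c1 by (metis count_eq_zero_iff zero_neq_one)
    then have "npent x v y = \<alpha> \<or> npent x v z = \<alpha> \<or> npent y v z = \<alpha>" using T[OF n] by auto
    then show ?thesis using n nb_swap nb_rotate unfolding M_def by blast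
  qed
  have uni: "u = u'" if M: "M v u" "M v u'" for v u u'
  proof (rule ccontr)
    assume ne: "u \<noteq> u'"
    obtain x y where 1: "nb v u x y" "npent x v y = \<alpha>" using M by (auto simp: M_def)
    obtain x' y' where 2: "nb v u' x' y'" "npent x' v y' = \<alpha>" using M by (auto simp: M_def)
    obtain z where z: "nb v u u' z" using 1 2 ne ex_nb2 nb_adj by metis
    have "npent u' v z = \<alpha>" using 1 npent_others[OF 1(1) z] by simp
    moreover have "npent u v z = \<alpha>" using 2 npent_others[OF 2(1) nb_swap[OF nb_rotate[OF z]]] by simp
    ultimately have "count T \<alpha> \<ge> 2" using T[OF z] by auto
    then show False using c1 by simp
  qed
  have sym: "M u v" if M: "M v u" for u v
  proof -
    obtain x y where n: "nb v u x y" "npent x v y = \<alpha>" using M by (auto simp: M_def)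
    obtain r s where n': "nb u v r s" using ex_nb1 adj_sym[OF nb_adj(1)[OF n(1)]] by blast
    have "\<Sum>\<^sub># T = npent u v x + npent u v y + npent x v y" using T[OF n(1)] by auto
    moreover have "\<Sum>\<^sub># T = npent v u r + npent v u s + npent r u s" using T[OF n'] by auto
    ultimately have "npent r u s = \<alpha>" using edge_weight_sym[OF n(1) n'] n(2) by linarith
    then show ?thesis using n' M_def by blast
  qed
  define m where "m v = (THE u. M v u)" for v
  have M: "M v u \<longleftrightarrow> u = m v" if v: "v \<in> verts G" for v u
  proof -
    obtain w where w: "M v w" using ex[OF v] by blast
    then have "m v = w" unfolding m_def by (rule the_equality) (rule uni[OF _ w])
    then show ?thesis using w uni by blast
  qed
  have adj: "adj v u" if "M v u" for v u using that nb_adj unfolding M_def by blast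
  have "m v \<in> verts G \<and> m (m v) = v \<and> adj v (m v) \<and>
      (\<forall>x y. nb v (m v) x y \<longrightarrow> npent x v y = \<alpha> \<and> {#npent (m v) v x, npent (m v) v y#} = T - {#\<alpha>#})"
    if v: "v \<in> verts G" for v
  proof -
    have Mv: "M v (m v)" using M v by simp
    then have mv: "m v \<in> verts G" "adj v (m v)" using adj adj_verts by blast+
    moreover have "m (m v) = v" using sym[OF Mv] M[OF mv(1)] by simp
    moreover have "npent x v y = \<alpha> \<and> {#npent (m v) v x, npent (m v) v y#} = T - {#\<alpha>#}"
      if n: "nb v (m v) x y" for x y
    proof -
      obtain r s where "nb v (m v) r s" "npent r v s = \<alpha>" using Mv by (auto simp: M_def)
      then have a: "npent x v y = \<alpha>" using n npent_others by metis
      show ?thesis using T[OF n] a by (auto simp: add_mset_commute)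
    qed
    ultimately show ?thesis by blast
  qed
  then show ?thesis by blast
qed

lemma ex_perfect_matching':
  assumes "T = {#\<beta>, \<beta>, \<alpha>#}" "\<alpha> \<noteq> \<beta>"
  obtains m where "\<And>v. v \<in> verts G \<Longrightarrow> m v \<in> verts G \<and> m (m v) = v \<and> adj v (m v)"
    and "\<And>v x y. nb v (m v) x y \<Longrightarrow> npent x v y = \<alpha> \<and> npent (m v) v x = \<beta> \<and> npent (m v) v y = \<beta>"
proof -
  have "count T \<alpha> = 1" using assms by simp
  then obtain m where m: "\<forall>v \<in> verts G. m v \<in> verts G \<and> m (m v) = v \<and> adj v (m v) \<and>
    (\<forall>x y. nb v (m v) x y \<longrightarrow> npent x v y = \<alpha> \<and> {#npent (m v) v x, npent (m v) v y#} = T - {#\<alpha>#})"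
    using ex_perfect_matching by blast
  have "T - {#\<alpha>#} = {#\<beta>, \<beta>#}" using assms by simp
  moreover have "x = \<beta> \<and> y = \<beta>" if "{#x, y#} = {#\<beta>, \<beta>#}" for x y :: nat
    using arg_cong[OF that, of set_mset] by auto
  ultimately show thesis using m nb_verts by (intro that[of m]) metis+
qed

section \<open>Refutation of single multisets\<close>

lemma T_ne_0: "T \<noteq> {#0, 0, 0#}"
proof
  assume T0: "T = {#0, 0, 0#}"
  obtain a b c d e where q: "pentagon a b c d e" using ex_pentagon by blast
  then have "adj b a" "adj b c" "a \<noteq> c" using pentagon_distinct[OF q] adj_sym
    unfolding pentagon_def by auto
  then obtain z where n: "nb b a c z" using ex_nb2 by blast
  have "npent a b c \<in># T" using T[OF n] by auto
  then show False using T0 pentagon_npent[OF q] by auto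
qed

text \<open>A 2-path on no 5-cycle is one that avoids the matching edge, so the matching edges would
  alternate along a 5-cycle.\<close>

lemma count_0_ne_1: "count T 0 \<noteq> 1"
proof
  assume "count T 0 = 1"
  then obtain m where m: "\<And>v. v \<in> verts G \<Longrightarrow> m v \<in> verts G \<and> m (m v) = v \<and> adj v (m v)"
    "\<And>v x y. v \<in> verts G \<Longrightarrow> nb v (m v) x y \<Longrightarrow> npent x v y = 0"
    using ex_perfect_matching by metis
  have mate: "m b = a \<or> m b = c" if q: "pentagon a b c d e" for a b c d e
  proof (rule ccontr)
    assume ne: "\<not> (m b = a \<or> m b = c)"
    have b: "b \<in> verts G" "adj b a" "adj b c" "a \<noteq> c" using q adj_verts adj_sym 
      pentagon_distinct[OF q] unfolding pentagon_def by auto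
    then obtain z where z: "nb b a c z" using ex_nb2 by blast
    then have "m b = z" using ne m(1)[OF b(1)] nb_adj_iff by blast
    then have "nb b (m b) a c" using z nb_rotate by blast
    then show False using m(2)[OF b(1)] pentagon_npent[OF q] by simp
  qed
  obtain a b c d e where q: "pentagon a b c d e" using ex_pentagon by blast
  note q1 = pentagon_rotate[OF q] note q2 = pentagon_rotate[OF q1]
  note q3 = pentagon_rotate[OF q2] note q4 = pentagon_rotate[OF q3]
  have "{a, b, c, d, e} \<subseteq> verts G" using q adj_verts unfolding pentagon_def by auto
  then have "m (m a) = a" "m (m b) = b" "m (m c) = c" "m (m d) = d" "m (m e) = e"
    using m(1) by auto
  then show False
    using mate[OF q] mate[OF q1] mate[OF q2] mate[OF q3] mate[OF q4] pentagon_distinct[OF q]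
    by auto
qed

text \<open>2-paths through matching edges have count 0, so all 5-cycles stay in the complementary
  2-factor. There a 2-path extends in only one way at either end and cannot lie on two
  5-cycles.\<close>

lemma T_ne_002: "T \<noteq> {#0, 0, 2#}"
proof
  assume T2: "T = {#0, 0, 2#}"
  then obtain m where m: "\<And>v. v \<in> verts G \<Longrightarrow> m v \<in> verts G \<and> m (m v) = v \<and> adj v (m v)"
    "\<And>v x y. nb v (m v) x y \<Longrightarrow> npent x v y = 2 \<and> npent (m v) v x = 0 \<and> npent (m v) v y = 0"
    by (rule ex_perfect_matching') (simp, blast)
  have mate: "nb b (m b) a c" if "pentagon a b c d e" for a b c d e
    using pentagon_avoids_mate[of m] m that by blast
  obtain a b c d e where q: "pentagon a b c d e" using ex_pentagon by blast
  note q1 = pentagon_rotate[OF q] note q2 = pentagon_rotate[OF q1]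
  note q3 = pentagon_rotate[OF q2] note q4 = pentagon_rotate[OF q3]
  have b: "b \<in> verts G" using q adj_verts unfolding pentagon_def by auto
  have pb: "npent a b c = 2" using m(2)[OF mate[OF q]] by simp
  have na: "nb a b (m a) e" using mate[OF q4] nb_rotate nb_swap by blast
  have nc: "nb c b d (m c)" using mate[OF q1] nb_rotate by blast
  have "\<not> (adj (m a) (m c) \<and> adj e d)" "\<not> (adj (m a) d \<and> adj e (m c))"
  proof -
    have *: "\<not> adj e (m c)"
    proof
      assume "adj e (m c)"
      then have "pentagon b c (m c) e a" using q nb_adj[OF nc] adj_sym unfolding pentagon_def by blast
      from mate[OF this] show False using nb_distinct by blast
    qed
    then show "\<not> (adj (m a) d \<and> adj e (m c))" by blast
    have "\<not> adj (m a) (m c)"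
    proof
      assume "adj (m a) (m c)"
      then have "pentagon b c (m c) (m a) a" using q nb_adj[OF nc] nb_adj[OF na] adj_sym
        unfolding pentagon_def by blast
      from mate[OF this] show False using nb_distinct by blast
    qed
    then show "\<not> (adj (m a) (m c) \<and> adj e d)" by blast
  qed
  moreover have "a \<noteq> c" using pentagon_distinct[OF q] by simp
  ultimately show False using npent_eq_2[OF na nc _ pb] by blast
qed

text \<open>2-paths of the 2-factor have count 2. So a path \<open>a, b, c, d, e\<close> in it is
  either straight (\<open>a\<close> adjacent to \<open>e\<close>, and \<open>m b\<close> to
  \<open>m d\<close>) or crossed (\<open>a\<close> adjacent to \<open>m d\<close>, and
  \<open>m b\<close> to \<open>e\<close>). Crossed paths are impossible; if all paths are straight,
  there is a triangle or a 2-path through a matching edge with count 2 instead of 1.\<close>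

lemma T_ne_112: "T \<noteq> {#1, 1, 2#}"
proof
  assume T2: "T = {#1, 1, 2#}"
  then obtain m where m: "\<And>v. v \<in> verts G \<Longrightarrow> m v \<in> verts G \<and> m (m v) = v \<and> adj v (m v)"
    "\<And>v x y. nb v (m v) x y \<Longrightarrow> npent x v y = 2 \<and> npent (m v) v x = 1 \<and> npent (m v) v y = 1"
    by (rule ex_perfect_matching') (simp, blast)
  have mm: "m (m v) = v" if "nb v x y z" for v x y z using m(1) that nb_verts by blast
  \<comment> \<open>\<open>x\<close> and \<open>y\<close> are the neighbours of \<open>v\<close> in the 2-factor complementary to the matching \<open>m\<close>.\<close>
  define nm where "nm v x y \<longleftrightarrow> nb v (m v) x y" for v x y
  have nmI: "nm v x y" if "adj v x" "adj v y" "x \<noteq> y" "m v \<noteq> x" "m v \<noteq> y" for v x y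
    using that ex_nb2[of v x y] m(1) adj_verts(1)[of v x] nb_adj_iff nb_rotate unfolding nm_def by metis
  have nm_sym: "nm v y x" if "nm v x y" for v x y using that nb_swap unfolding nm_def by blast
  have ex_nm: "\<exists>y. nm v x y" if "adj v x" "m v \<noteq> x" for v x
    using that ex_nb2[of v "m v" x] m(1) adj_verts unfolding nm_def by blast
  have nmD: "adj v x" "adj v y" "x \<noteq> y" "m v \<noteq> x" "m v \<noteq> y" "adj v (m v)" "m (m v) = v"
    "adj v u \<longleftrightarrow> u = m v \<or> u = x \<or> u = y"
    if "nm v x y" for v x y u
    using that nb_adj[of v "m v" x y] nb_distinct[of v "m v" x y] mm[of v "m v" x y]
      nb_adj_iff[of v "m v" x y u] unfolding nm_def by auto
  have two: "adj a e \<and> adj (m b) (m d) \<or> adj a (m d) \<and> adj (m b) e"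
    if "nm c b d" "nm b a c" "nm d c e" for a b c d e
  proof -
    have "nb b c a (m b)" "nb d c e (m d)" "b \<noteq> d" "npent b c d = 2"
      using that nmD(3) nb_rotate nb_swap m(2)[of c b d] nb_verts unfolding nm_def by blast+
    then show ?thesis using npent_eq_2 by blast
  qed
  \<comment> \<open>In the crossed case the edge from \<open>a\<close> to \<open>m d\<close> belongs
    to the 2-factor, so \<open>m d, a, b, c, d\<close> is again a path in it. Its crossed pattern
    would make \<open>m a\<close> adjacent to \<open>d\<close>, hence it is straight.\<close>
  have cross1: "nm a b (m d)" "a \<noteq> e" "m a \<noteq> e" "adj (m a) (m c)"
    if t: "nm c b d" "nm b a c" "nm d c e" and x: "adj a (m d)" "adj (m b) e" for a b c d e
  proof -
    note D = nmD[OF t(1)] nmD[OF t(2)] nmD[OF t(3)]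
    have bd: "\<not> adj b d" using D no_triangle adj_sym by blast
    have ac: "\<not> adj a c" using D no_triangle adj_sym by blast
    have "a \<noteq> d" using bd D by blast
    have va: "m (m a) = a" using m(1) x adj_verts by blast
    have "m d \<noteq> b" using bd D by auto
    moreover have "m a \<noteq> b" using va D by metis
    moreover have "m a \<noteq> m d" using va D \<open>a \<noteq> d\<close> by metis
    ultimately show na: "nm a b (m d)" using D x adj_sym by (intro nmI) auto
    show ae: "a \<noteq> e"
      using no_square[of a b c d] D adj_sym \<open>a \<noteq> d\<close> ac bd by metis
    have be: "b \<noteq> e" using bd D adj_sym by blast
    show mae: "m a \<noteq> e"
    proof
      assume "m a = e"
      then have "adj a e" using nmD[OF na] by metis
      moreover have "a \<noteq> m b" using D by metis
      ultimately show False using no_square[of a b "m b" e] D x be adj_sym by metis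
    qed
    have "\<not> adj (m a) d"
    proof
      assume "adj (m a) d"
      then have "m a = m d \<or> m a = c \<or> m a = e" using D adj_sym by metis
      moreover have "m a \<noteq> c" using ac nmD[OF na] by metis
      ultimately show False using mae \<open>m a \<noteq> m d\<close> by blast
    qed
    then show "adj (m a) (m c)"
      using two[OF t(2) nm_sym[OF na] t(1)] by blast
  qed
  \<comment> \<open>The second alternative in \<open>two\<close> closes up \<open>m d, a, b, c, d, e, m b, f\<close> to an 8-cycle of the
    2-factor, and the mates of \<open>a, c, e, f\<close> then form a 4-cycle.\<close>
  have no_cross: False
    if t: "nm c b d" "nm b a c" "nm d c e" and x: "adj a (m d)" "adj (m b) e" for a b c d e
  proof -
    note D = nmD[OF t(1)] nmD[OF t(2)] nmD[OF t(3)]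
    note F = cross1[OF t x]
    have x': "adj e (m b)" "adj (m d) a" using x adj_sym by blast+
    \<comment> \<open>The reversed path \<open>e, d, c, b, a\<close> is crossed as well and gives
      the mirror images of the facts \<open>F\<close>.\<close>
    note B = cross1[OF nm_sym[OF t(1)] nm_sym[OF t(3)] nm_sym[OF t(2)] x']
    note D' = nmD[OF F(1)] nmD[OF B(1)]
    have mb: "adj (m b) e" "m (m b) = b" "adj (m b) b" using x D adj_sym by auto
    have "b \<noteq> e" using D adj_sym no_triangle by blast
    then obtain f where f: "nm (m b) e f" using ex_nm mb by metis
    note Df = nmD[OF f]
    have "\<not> adj (m d) b"
    proof
      assume "adj (m d) b"
      then have "m d = m b \<or> m d = a \<or> m d = c" using D adj_sym by blast
      moreover have "m d \<noteq> a" using D'(2) by auto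
      moreover have "m d \<noteq> m b" using D by metis
      ultimately show False using D by blast
    qed
    then have df: "adj (m d) f" using two[OF B(1) t(3) f] mb by auto
    have "m b \<noteq> m d" using D by metis
    moreover have "m (m f) = f" using m(1) df adj_verts by blast
    moreover have "f \<noteq> d" using no_triangle[of e "m b" f] x'(1) Df(2) D'(9) adj_sym by metis
    moreover have "f \<noteq> b" using Df mb by metis
    ultimately have "m f \<noteq> m b" "m f \<noteq> m d" using mb D by metis+
    then have nf: "nm f (m b) (m d)" using Df df adj_sym \<open>m b \<noteq> m d\<close> by (intro nmI) auto
    note Df' = nmD[OF nf]
    have "a \<noteq> d" using D no_triangle adj_sym by blast
    have "\<not> adj a (m b)" using D D' adj_irrefl by metis
    then have "a \<noteq> f" using Df' by blast
    moreover have "d \<noteq> f" using Df' by metis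
    ultimately have nmd: "nm (m d) a f" using D x' df \<open>a \<noteq> d\<close> by (intro nmI) auto
    note Dd' = nmD[OF nmd]
    have "m e \<noteq> f" using D' Df no_triangle adj_sym by metis
    then have "\<not> adj (m e) (m d)" using B(3) Dd'(8)[of "m e"] D D'(12) adj_sym by metis
    then have ef: "adj (m e) (m f)" using two[OF f B(1) nf] by blast
    have "m a \<noteq> f" using D' Dd' no_triangle adj_sym by metis
    then have "\<not> adj (m a) (m b)" using F(3) Df(8)[of "m a"] mb D'(4) adj_sym by metis
    then have af: "adj (m a) (m f)" using two[OF nmd F(1) nm_sym[OF nf]] by blast
    have "m a \<noteq> m e" using F(2) D' by metis
    moreover have "\<not> adj c (m b)" using D D' adj_irrefl by metis
    then have "m c \<noteq> m f" using Df' D by metis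
    ultimately
    show False
      using no_square[of "m a" "m c" "m e" "m f"] F(4) B(4) ef af adj_sym by blast
  qed
  have par: "adj a e" "adj (m b) (m d)" if "nm c b d" "nm b a c" "nm d c e" for a b c d e
    using two[OF that] no_cross[OF that] by blast+
  obtain c where "c \<in> verts G" using connected by (auto simp: connected_graph_def)
  then obtain b d where c: "nm c b d" using m(1) ex_nb1 unfolding nm_def by blast
  note Dc = nmD[OF c]
  have mm': "m (m v) = v" if "adj u v" for u v using that m(1) adj_verts by blast
  have "m b \<noteq> c" "m d \<noteq> c" using Dc mm' by metis+
  then obtain a e where b: "nm b a c" and d: "nm d c e"
    using ex_nm[of b c] ex_nm[of d c] Dc nm_sym adj_sym by blast
  note Db = nmD[OF b] note Dd = nmD[OF d]
  note pc = par[OF c b d]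
  have bd: "\<not> adj b d" using no_triangle[of b c d] Db(2) Dc(2) adj_sym by blast
  have ac: "\<not> adj a c" using no_triangle[of a b c] Db(1,2) adj_sym by blast
  have ec: "\<not> adj e c" using no_triangle[of e d c] Dd(1,2) adj_sym by blast
  have med: "m e \<noteq> d" using Dd mm' by metis
  show False
  proof (cases "m e = a")
    case True
    \<comment> \<open>The edge closing the path is a matching edge, so the 2-factor continues from
      \<open>e\<close> to some \<open>x\<close>. As \<open>b, c, d, e, x\<close> is straight,
      \<open>x\<close> is \<open>m b\<close>; the next vertex \<open>y\<close> is then
      \<open>m d\<close>, and straightness of \<open>c, d, e, x, y\<close> closes the triangle
      \<open>c, d, y\<close>.\<close>
    obtain x where e: "nm e d x" using med ex_nm Dd adj_sym by blast
    note De = nmD[OF e]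
    note pd = par[OF d c e]
    have "x \<noteq> a" "x \<noteq> c" using True De ec by metis+
    then have x: "x = m b" using pd Db by blast
    have "m x \<noteq> e" using x Db bd Dd adj_sym by metis
    then obtain y where y: "nm x e y" using ex_nm De adj_sym by blast
    have "m d = b \<or> m d = e \<or> m d = y" using pc(2) nmD[OF y] x Db by metis
    then have "m d = y" using bd Dd adj_sym by metis
    then show False using no_triangle[of c d y] par(1)[OF e d y] Dc(2) Dd(6) adj_sym by blast
  next
    case False
    \<comment> \<open>Now \<open>a, b, c, d, e\<close> is a 5-cycle of the 2-factor, and mates of
      vertices at distance 2 on it are adjacent, as in the Petersen graph. So
      \<open>m a, a, b\<close> lies on two 5-cycles, one through \<open>m c, c\<close> and one
      through \<open>m d, m b\<close>.\<close>
    have e: "nm e d a" using Dd pc adj_sym bd Db med False by (intro nmI) auto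
    note De = nmD[OF e]
    have "e \<noteq> b" using bd Dd adj_sym by blast
    moreover have "m a \<noteq> e" "m a \<noteq> b" using False Db mm' De by metis+
    ultimately have a: "nm a e b" using pc Db adj_sym by (intro nmI) auto
    note Da = nmD[OF a]
    have 1: "adj (m a) (m c)" using par(2)[OF b a c] .
    have 2: "adj (m d) (m a)" using par(2)[OF e d a] .
    have "\<not> adj a d" using no_triangle[of a e d] pc(1) Dd(2) adj_sym by blast
    then have "m c \<noteq> m d" "a \<noteq> m c" "a \<noteq> m d" using ac Da Dc Dd adj_sym adj_irrefl by metis+
    then have n: "nb (m a) a (m c) (m d)" using 1 2 Da adj_sym by (intro nbI) auto
    have n': "nb b a c (m b)" using b nb_rotate unfolding nm_def by blast
    have "npent (m a) a b = 1" using a m(2) unfolding nm_def by blast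
    moreover have "adj (m c) c" "adj (m d) (m b)" using Dc pc(2) adj_sym by blast+
    ultimately show False unfolding npent_eq[OF n n'] by simp
  qed
qed

text \<open>2-paths through the matching edge from \<open>b\<close> to \<open>bs\<close> have count
  2, which matches the outer neighbours of \<open>bs\<close> perfectly with those of
  \<open>a\<close> and those of \<open>c\<close>. The count 1 of \<open>a, b, c\<close> leaves a
  single edge between the latter two pairs, say from \<open>r1\<close> to \<open>s2\<close>. Then
  \<open>a, r1, r\<close> has count 1, so \<open>r1\<close> is not the mate of \<open>a\<close>; the
  mate must be \<open>s1\<close>, but \<open>s1, a, b\<close> has count less than 2.\<close>

lemma T_ne_122: "T \<noteq> {#2, 2, 1#}"
proof
  assume "T = {#2, 2, 1#}"
  then obtain m where m: "\<And>v. v \<in> verts G \<Longrightarrow> m v \<in> verts G \<and> m (m v) = v \<and> adj v (m v)"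
    "\<And>v x y. nb v (m v) x y \<Longrightarrow> npent x v y = 1 \<and> npent (m v) v x = 2 \<and> npent (m v) v y = 2"
    by (rule ex_perfect_matching') (simp, blast)
  have False
    if b: "nb b bs a c" "m b = bs" and bs: "nb bs b r s"
      and a: "nb a b r1 s1" and c: "nb c b r2 s2"
      and e: "adj r r1" "adj s s1" "adj r r2" "adj s s2" "adj r1 s2" "\<not> adj s1 r2"
    for b bs a c r s r1 s1 r2 s2
  proof -
    note N = nb_adj[OF b(1)] nb_adj[OF bs] nb_adj[OF a] nb_adj[OF c]
    note N' = nb_distinct[OF b(1)] nb_distinct[OF bs] nb_distinct[OF a] nb_distinct[OF c]
    have 1: "\<not> adj a bs" "\<not> adj c bs" "\<not> adj a c" "\<not> adj b r" "\<not> adj b s" "\<not> adj b r1" "\<not> adj b s1"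
      "\<not> adj b r2" "\<not> adj b s2" "\<not> adj r s" "\<not> adj r1 s1" "\<not> adj r2 s2"
      using N no_triangle adj_sym by blast+
    have 2: "r1 \<noteq> r2" "r1 \<noteq> s2" "s1 \<noteq> r2" "s1 \<noteq> s2"
      using N N' unique_common_neighbour[of a _ c b] adj_sym 1 by metis+
    have 3: "r1 \<noteq> bs" "s1 \<noteq> bs" "r2 \<noteq> bs" "s2 \<noteq> bs" "a \<noteq> r" "a \<noteq> s" "c \<noteq> r" "c \<noteq> s"
      using 1 N adj_sym by blast+
    have r: "nb r bs r1 r2" and s: "nb s bs s1 s2"
      using N e 2 3 adj_sym by (auto intro!: nbI)
    have r1: "nb r1 r a s2"
      using N e 1 3 adj_sym by (intro nbI) auto
    have s2: "nb s2 s c r1"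
      using N e 1 3 adj_sym by (intro nbI) auto
    have na: "nb a r1 b s1" and nr: "nb r r1 bs r2"
      using a r nb_rotate nb_swap by blast+
    have "\<not> adj s1 bs" using nb_adj_iff[OF bs, of s1] 1 e adj_sym adj_irrefl by metis
    then have "npent a r1 r = 1" unfolding npent_eq[OF na nr] using N 1 e by simp
    \<comment> \<open>Every 2-path at \<open>r1\<close> through its mate has count 2, so the mate is
      neither end of \<open>a, r1, r\<close>.\<close>
    moreover have "m r1 = a \<Longrightarrow> npent a r1 r = 2" "m r1 = r \<Longrightarrow> npent a r1 r = 2"
      using m(2)[of r1 s2 r] m(2)[of r1 a s2] r1 nb_rotate npent_commute by metis+
    ultimately have "m r1 \<noteq> a" by auto
    then have "m a \<noteq> r1" using m(1)[OF nb_verts[OF a]] by auto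
    moreover have "m a \<noteq> b" using m(1)[OF nb_verts[OF a]] b(2) N'(1) by auto
    ultimately have ma: "m a = s1" using m(1)[OF nb_verts[OF a]] nb_adj_iff[OF a, of "m a"] by blast
    then have "npent s1 a b = 2" using m(2)[of a b r1] a nb_rotate by metis
    then have pa: "npent b a s1 = 2" using npent_commute by metis
    have nb': "nb b a c bs" using b nb_rotate by blast
    obtain t where t: "nb s1 a s t" using ex_nb2[of s1 a s] N e 3 adj_sym by blast
    note Nt = nb_adj[OF t] nb_distinct[OF t]
    have "\<not> adj c s" using nb_adj_iff[OF c, of s] 1 e adj_sym adj_irrefl by metis
    moreover have "\<not> adj c t"
      using nb_adj_iff[OF c, of t] 1 e Nt(3) no_triangle adj_sym by metis
    moreover have "\<not> adj bs t"
      using nb_adj_iff[OF bs, of t] nb_adj_iff[OF r, of s1] 1 2 3 N' Nt adj_sym by metis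
    ultimately show False using pa unfolding npent_eq[OF nb' t] of_bool_def by (simp split: if_splits)
  qed
  note * = this
  obtain b where "b \<in> verts G" using connected by (auto simp: connected_graph_def)
  then obtain a c where b: "nb b (m b) a c" using m(1) ex_nb1 by blast
  obtain r s where bs: "nb (m b) b r s" using ex_nb1[OF adj_sym[OF nb_adj(1)[OF b]]] by blast
  note pb = m(2)[OF b]
  have ex: "\<exists>x y. nb a b x y \<and> adj r x \<and> adj s y" if a: "adj b a" "npent (m b) b a = 2" "a \<noteq> m b" for a
  proof -
    obtain x y where n: "nb a b x y" using ex_nb1 a adj_sym by blast
    from npent_eq_2[OF bs n] a show ?thesis using n nb_swap by metis
  qed
  have ne: "a \<noteq> m b" "c \<noteq> m b" using nb_distinct[OF b] by auto
  obtain r1 s1 where a: "nb a b r1 s1" "adj r r1" "adj s s1" using ex[of a] pb ne nb_adj[OF b] by blast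
  obtain r2 s2 where c: "nb c b r2 s2" "adj r r2" "adj s s2" using ex[of c] pb ne nb_adj[OF b] by blast
  \<comment> \<open>These edges would close triangles with \<open>r\<close> and \<open>s\<close>.
    The two that remain possible are exchanged by swapping \<open>r\<close> and
    \<open>s\<close>.\<close>
  have "\<not> adj r1 r2" "\<not> adj s1 s2" using a c no_triangle adj_sym by blast+
  then have "adj r1 s2 \<and> \<not> adj s1 r2 \<or> adj s1 r2 \<and> \<not> adj r1 s2"
    using pb unfolding npent_eq[OF a(1) c(1)] of_bool_def by (auto split: if_splits)
  then show False
    using *[OF b refl bs a(1) c(1) a(2,3) c(2,3)]
      *[OF b refl nb_swap[OF bs] nb_swap[OF a(1)] nb_swap[OF c(1)] a(3,2) c(3,2)] by blast
qed

end

section \<open>The Petersen graph and the dodecahedron\<close>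

text \<open>The entries of \<open>A\<close> are lists of positions in \<open>vs\<close>.\<close>

definition adjacency_list :: "'a sgraph \<Rightarrow> 'a list \<Rightarrow> nat list list \<Rightarrow> bool" where
  "adjacency_list G vs A \<longleftrightarrow> distinct vs \<and> set vs = verts G \<and>
     list_all2 (\<lambda>v N. {u. adjacent G v u} = nth vs ` set N) vs A"

lemma adjacency_list_nth:
  assumes G: "adjacency_list G vs A" and A: "list_all (\<lambda>N. list_all (\<lambda>j. j < length A) N) A"
    and ij: "i < length A" "j < length A"
  shows "adjacent G (vs ! i) (vs ! j) \<longleftrightarrow> j \<in> set (A ! i)"
proof -
  have l: "length vs = length A" "distinct vs"
    using G by (auto simp: adjacency_list_def dest: list_all2_lengthD)
  have "{u. adjacent G (vs ! i) u} = nth vs ` set (A ! i)"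
    using G ij l by (auto simp: adjacency_list_def list_all2_conv_all_nth)
  then have "adjacent G (vs ! i) (vs ! j) \<longleftrightarrow> vs ! j \<in> nth vs ` set (A ! i)" by blast
  moreover have "set (A ! i) \<subseteq> {..<length A}" using A ij(1) by (auto simp: list_all_iff)
  ultimately show ?thesis using ij l by (auto simp: nth_eq_iff_index_eq image_iff)
qed

lemma isomorphic_if_same_adjacency_list:
  assumes G: "adjacency_list G vs A" and H: "adjacency_list H ws A"
    and A: "list_all (\<lambda>N. list_all (\<lambda>j. j < length A) N) A"
  shows "G \<cong>\<^sub>G H"
proof -
  let ?n = "length A"
  let ?f = "nth ws \<circ> the_inv_into {..<?n} (nth vs)"
  have len: "length vs = ?n" "length ws = ?n"
    using G H by (auto simp: adjacency_list_def dest: list_all2_lengthD)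
  have bG: "bij_betw (nth vs) {..<?n} (verts G)" and bH: "bij_betw (nth ws) {..<?n} (verts H)"
    using G H len by (auto simp: adjacency_list_def intro!: bij_betw_nth)
  have "bij_betw ?f (verts G) (verts H)"
    using bij_betw_trans[OF bij_betw_the_inv_into[OF bG] bH] .
  moreover have "adjacent G u v \<longleftrightarrow> adjacent H (?f u) (?f v)" if uv: "u \<in> verts G" "v \<in> verts G" for u v
  proof -
    obtain i j where i: "i < ?n" "u = vs ! i" and j: "j < ?n" "v = vs ! j"
      using uv unfolding bij_betw_imp_surj_on[OF bG, symmetric] by blast
    have "?f u = ws ! i" "?f v = ws ! j"
      using i j bG by (auto simp: bij_betw_def the_inv_into_f_f)
    then show ?thesis using adjacency_list_nth[OF G A] adjacency_list_nth[OF H A] i j by simp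
  qed
  ultimately show ?thesis unfolding isomorphic_def by blast
qed

section \<open>Adjacency tables of the two target graphs\<close>

definition petersen_list :: "nat set list" where
  "petersen_list = [{0,1}, {2,3}, {2,4}, {3,4}, {0,4}, {1,4}, {1,3}, {0,3}, {1,2}, {0,2}]"

text \<open>Vertices are ordered by distance from the first one, those at distance 2 in pairs
  according to their neighbour at position 1, 2 or 3. The reconstruction from a ball of radius 2
  lists its vertices in the same order.\<close>

definition petersen_table :: "nat list list" where
  "petersen_table = [[1,2,3], [0,4,5], [0,6,7], [0,8,9], [1,6,8], [1,7,9], [2,4,9], [2,5,8],
     [3,4,7], [3,5,6]]"

lemma set_petersen_list: "set petersen_list = {A. A \<subseteq> {..<5} \<and> card A = 2}"
proof (intro set_eqI iffI)
  fix A :: "nat set" assume "A \<in> {A. A \<subseteq> {..<5} \<and> card A = 2}"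
  then obtain i j where A: "A = {i, j}" and "i \<noteq> j" "i < 5" "j < 5"
    by (auto simp: card_2_iff)
  then have "i \<in> {0,1,2,3,4}" "j \<in> {0,1,2,3,4}" by auto
  then show "A \<in> set petersen_list" using \<open>i \<noteq> j\<close> unfolding A petersen_list_def
    by (elim insertE emptyE) (simp_all add: insert_commute)
qed (auto simp: petersen_list_def)

lemma adjacency_list_petersen: "adjacency_list petersen_graph petersen_list petersen_table"
proof -
  have "{B. adjacent petersen_graph A B} = set (filter (\<lambda>B. A \<inter> B = {}) petersen_list)"
    if "A \<in> set petersen_list" for A
    using that unfolding set_filter set_petersen_list
    by (auto simp: adjacent_def petersen_graph_def doubleton_eq_iff)
  then have "list_all (\<lambda>A. {B. adjacent petersen_graph A B} =
      set (filter (\<lambda>B. A \<inter> B = {}) petersen_list)) petersen_list"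
    by (simp add: list_all_iff)
  moreover have "list_all2 (\<lambda>A N. set (filter (\<lambda>B. A \<inter> B = {}) petersen_list) =
      nth petersen_list ` set N) petersen_list petersen_table"
    by (simp add: petersen_list_def petersen_table_def)
  ultimately have "list_all2 (\<lambda>A N. {B. adjacent petersen_graph A B} = nth petersen_list ` set N)
      petersen_list petersen_table"
    by (simp add: list_all2_conv_all_nth list_all_length)
  moreover have "distinct petersen_list" by (simp add: petersen_list_def doubleton_eq_iff)
  moreover have "set petersen_list = verts petersen_graph"
    by (simp add: set_petersen_list petersen_graph_def)
  ultimately show ?thesis by (simp add: adjacency_list_def)
qed

text \<open>The order is by rings of five: top face, even belt vertices, odd belt vertices, bottom
  face. Successive entries of a ring differ by 2, so the position inside a ring is an index modulo
  5.\<close>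

definition dodecahedron_list :: "(bool \<times> nat) list" where
  "dodecahedron_list =
     [(True,0), (True,2), (True,4), (True,6), (True,8),
      (False,0), (False,2), (False,4), (False,6), (False,8),
      (False,1), (False,3), (False,5), (False,7), (False,9),
      (True,1), (True,3), (True,5), (True,7), (True,9)]"

definition dodecahedron_table :: "nat list list" where
  "dodecahedron_table =
     [[1,4,5], [2,0,6], [3,1,7], [4,2,8], [0,3,9],
      [0,14,10], [1,10,11], [2,11,12], [3,12,13], [4,13,14],
      [5,6,15], [6,7,16], [7,8,17], [8,9,18], [9,5,19],
      [10,16,19], [11,17,15], [12,18,16], [13,19,17], [14,15,18]]"

text \<open>An executable test that agrees with adjacency for indices below 10; filtering the vertex
  list with it lets simplification confirm the table.\<close>

fun dodecahedron_adj :: "bool \<times> nat \<Rightarrow> bool \<times> nat \<Rightarrow> bool" where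
  "dodecahedron_adj (False, i) (False, j) \<longleftrightarrow> j = (i + 1) mod 10 \<or> i = (j + 1) mod 10"
| "dodecahedron_adj (True, i) (True, j) \<longleftrightarrow> j = (i + 2) mod 10 \<or> i = (j + 2) mod 10"
| "dodecahedron_adj (_, i) (_, j) \<longleftrightarrow> i = j"

lemma set_dodecahedron_list: "set dodecahedron_list = UNIV \<times> {..<10}"
proof -
  have "{..<10::nat} = {0,1,2,3,4,5,6,7,8,9}" by auto
  then show ?thesis by (auto simp: dodecahedron_list_def UNIV_bool)
qed

lemma adjacent_dodecahedron:
  "adjacent dodecahedron_graph v w \<longleftrightarrow>
     v \<in> UNIV \<times> {..<10} \<and> w \<in> UNIV \<times> {..<10} \<and> dodecahedron_adj v w"
proof -
  obtain a i b j where [simp]: "v = (a, i)" "w = (b, j)" by (cases v, cases w)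
  show ?thesis
    by (cases a; cases b) (auto simp: adjacent_def dodecahedron_graph_def doubleton_eq_iff)
qed

lemma adjacency_list_dodecahedron:
  "adjacency_list dodecahedron_graph dodecahedron_list dodecahedron_table"
proof -
  have "{w. adjacent dodecahedron_graph v w} = set (filter (dodecahedron_adj v) dodecahedron_list)"
    if "v \<in> set dodecahedron_list" for v
    using that unfolding set_filter set_dodecahedron_list adjacent_dodecahedron by blast
  then have "list_all (\<lambda>v. {w. adjacent dodecahedron_graph v w} =
      set (filter (dodecahedron_adj v) dodecahedron_list)) dodecahedron_list"
    by (simp add: list_all_iff)
  moreover have "list_all2 (\<lambda>v N. set (filter (dodecahedron_adj v) dodecahedron_list) =
      nth dodecahedron_list ` set N) dodecahedron_list dodecahedron_table"
    by (simp add: dodecahedron_list_def dodecahedron_table_def insert_commute)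
  ultimately have "list_all2 (\<lambda>v N. {w. adjacent dodecahedron_graph v w} =
      nth dodecahedron_list ` set N) dodecahedron_list dodecahedron_table"
    by (simp add: list_all2_conv_all_nth list_all_length)
  moreover have "distinct dodecahedron_list" by (simp add: dodecahedron_list_def)
  moreover have "set dodecahedron_list = verts dodecahedron_graph"
    by (simp add: set_dodecahedron_list dodecahedron_graph_def)
  ultimately show ?thesis by (simp add: adjacency_list_def)
qed

section \<open>Recognition of the Petersen graph\<close>

context girth_regular_cubic5
begin

text \<open>The rows of the table contain only valid positions, so the listed vertices are closed
  under adjacency; by connectedness they are all the vertices.\<close>

lemma adjacency_listI:
  assumes "distinct vs" "vs \<noteq> []" and sub: "set vs \<subseteq> verts G"
    and nbs: "list_all2 (\<lambda>v N. {u. adj v u} = nth vs ` set N) vs A"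
    and A: "list_all (\<lambda>N. list_all (\<lambda>j. j < length A) N) A"
  shows "adjacency_list G vs A"
proof -
  have len: "length A = length vs" using nbs by (simp add: list_all2_lengthD)
  have closed: "w \<in> set vs" if "v \<in> set vs" "adj v w" for v w
  proof -
    obtain i where i: "i < length vs" "v = vs ! i" using \<open>v \<in> set vs\<close> by (metis in_set_conv_nth)
    then have "w \<in> nth vs ` set (A ! i)"
      using nbs \<open>adj v w\<close> unfolding list_all2_conv_all_nth by blast
    moreover have "set (A ! i) \<subseteq> {..<length vs}"
      using A i len by (auto simp: list_all_iff)
    ultimately show ?thesis by auto
  qed
  obtain v0 where v0: "v0 \<in> set vs" using assms(2) by (cases vs) auto
  have "w \<in> set vs" if "w \<in> verts G" for w
  proof -
    have "adj\<^sup>*\<^sup>* v0 w" using connected v0 sub that by (auto simp: connected_graph_def)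
    then show ?thesis by (induction rule: rtranclp_induct) (use v0 closed in auto)
  qed
  then show ?thesis using sub assms by (auto simp: adjacency_list_def)
qed


text \<open>The vertices at distance 2 from \<open>v\<close> form three pairs, any two of which are
  joined by a perfect matching. The pairs at \<open>b\<close> and \<open>c\<close> are named after
  their partners in the pair at \<open>a\<close>, so only the matching between those two pairs is
  open. Then every vertex of the ball has its three neighbours inside it.\<close>

lemma isomorphic_petersen:
  assumes T2: "T = {#2, 2, 2#}"
  shows "G \<cong>\<^sub>G petersen_graph"
proof -
  obtain v where "v \<in> verts G" using connected by (auto simp: connected_graph_def)
  then obtain a b c where v: "nb v a b c" using ex_nb by blast
  have "npent a v b \<in># T" "npent a v c \<in># T" "npent b v c \<in># T" unfolding T[OF v, symmetric] by auto
  then have pv: "npent a v b = 2" "npent a v c = 2" "npent b v c = 2" unfolding T2 by auto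
  note Nv = nb_adj[OF v] nb_distinct[OF v]
  obtain a1 a2 where a: "nb a v a1 a2" using ex_nb1 Nv adj_sym by blast
  have ex: "\<exists>x y. nb b v x y \<and> adj a1 x \<and> adj a2 y" if vb: "adj v b" "npent a v b = 2" "a \<noteq> b" for b
  proof -
    obtain x y where n: "nb b v x y" using ex_nb1[OF adj_sym[OF vb(1)]] by blast
    from npent_eq_2[OF a n vb(3,2)] show ?thesis using n nb_swap by blast
  qed
  obtain b1 b2 where b: "nb b v b1 b2" and ab: "adj a1 b1" "adj a2 b2" using ex[of b] pv Nv by blast
  obtain c1 c2 where c: "nb c v c1 c2" and ac: "adj a1 c1" "adj a2 c2" using ex[of c] pv Nv by blast
  \<comment> \<open>Both are adjacent to \<open>a1\<close>, so the last matching must be the crossed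
    one.\<close>
  have "\<not> adj b1 c1" using ab ac no_triangle adj_sym by blast
  then have bc: "adj b1 c2" "adj b2 c1" using npent_eq_2[OF b c _ pv(3)] Nv by auto
  note N = nb_adj[OF a] nb_adj[OF b] nb_adj[OF c]
  note N' = nb_distinct[OF a] nb_distinct[OF b] nb_distinct[OF c]
  have 1: "\<not> adj a b" "\<not> adj a c" "\<not> adj b c" using Nv no_triangle adj_sym by blast+
  have 2: "x \<noteq> y" if "adj v a" "adj v b" "a \<noteq> b" "adj a x" "adj b y" "x \<noteq> v" for a b x y
    using unique_common_neighbour[of a v b x] that adj_sym by blast
  have ab': "a1 \<noteq> b1" "a1 \<noteq> b2" "a2 \<noteq> b1" "a2 \<noteq> b2"
    using 2[of a b] N N' Nv by auto
  have ac': "a1 \<noteq> c1" "a1 \<noteq> c2" "a2 \<noteq> c1" "a2 \<noteq> c2"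
    using 2[of a c] N N' Nv by auto
  have bc': "b1 \<noteq> c1" "b1 \<noteq> c2" "b2 \<noteq> c1" "b2 \<noteq> c2"
    using 2[of b c] N N' Nv by auto
  have 3: "a \<noteq> b1" "a \<noteq> b2" "a \<noteq> c1" "a \<noteq> c2" "b \<noteq> a1" "b \<noteq> a2" "b \<noteq> c1" "b \<noteq> c2"
    "c \<noteq> a1" "c \<noteq> a2" "c \<noteq> b1" "c \<noteq> b2"
    using 1 N adj_sym by blast+
  have 4: "v \<noteq> a" "v \<noteq> b" "v \<noteq> c" "a \<noteq> a1" "a \<noteq> a2" "b \<noteq> b1" "b \<noteq> b2" "c \<noteq> c1" "c \<noteq> c2"
    using N Nv by auto
  let ?vs = "[v, a, b, c, a1, a2, b1, b2, c1, c2]"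
  have d: "distinct ?vs" using 3 4 ab' ac' bc' N' Nv(4) by auto
  have S: "adj b v" "adj a1 a" "adj a2 a" "adj b1 b" "adj b2 b" "adj c1 c" "adj c2 c"
    "adj b1 a1" "adj b2 a2" "adj c1 a1" "adj c2 a2" "adj c2 b1" "adj c1 b2"
    using N ab ac bc adj_sym by blast+
  have n: "nb a1 a b1 c1" "nb a2 a b2 c2" "nb b1 b a1 c2" "nb b2 b a2 c1" "nb c1 c a1 b2" "nb c2 c a2 b1"
    using S ab ac bc d by (auto intro!: nbI)
  have "adjacency_list G ?vs petersen_table"
  proof (rule adjacency_listI[OF d])
    show "set ?vs \<subseteq> verts G" using n v a b c nb_verts by auto
    show "list_all2 (\<lambda>v N. {u. adj v u} = nth ?vs ` set N) ?vs petersen_table"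
      using n v a b c by (simp add: petersen_table_def nb_def)
  qed (simp_all add: petersen_table_def)
  then show ?thesis
    by (rule isomorphic_if_same_adjacency_list[OF _ adjacency_list_petersen])
      (simp add: petersen_table_def)
qed

end

section \<open>Indices modulo 5\<close>

lemma cases_5: "(i :: 5) = 0 \<or> i = 1 \<or> i = 2 \<or> i = 3 \<or> i = 4"
proof (cases i rule: bit1_cases)
  case (of_int z)
  then have "z = 0 \<or> z = 1 \<or> z = 2 \<or> z = 3 \<or> z = 4" by auto
  then show ?thesis using of_int by auto
qed

text \<open>Index shifts are at most 4, so adding two of them gives at most 8.\<close>

lemma numerals_5 [simp]: "(5 :: 5) = 0" "(6 :: 5) = 1" "(7 :: 5) = 2" "(8 :: 5) = 3"
  by simp_all

lemma all_shifts_5: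
  fixes i j :: 5
  assumes "P i" "P (i + 1)" "P (i + 2)" "P (i + 3)" "P (i + 4)"
  shows "P j"
proof -
  have "j = i + (j - i)" by simp
  with cases_5[of "j - i"] assms show ?thesis by (metis add.right_neutral)
qed

text \<open>Modulo 5 every nonzero difference is 1 or 2 up to sign.\<close>

lemma inj_5I:
  fixes f :: "5 \<Rightarrow> 'a"
  assumes "\<And>i. f i \<noteq> f (i + 1)" "\<And>i. f i \<noteq> f (i + 2)"
  shows "inj f"
proof (rule injI)
  fix i j :: 5
  have "f (i + 3) \<noteq> f i" "f (i + 4) \<noteq> f i" using assms(2)[of "i + 3"] assms(1)[of "i + 4"] by simp_all
  then show "f i = f j \<Longrightarrow> i = j"
    using all_shifts_5[of "\<lambda>j. f i = f j \<longrightarrow> i = j" i j] assms[of i] by metis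
qed

section \<open>Recognition of the dodecahedron\<close>

context girth_regular_cubic5
begin

lemma isomorphic_dodecahedron:
  assumes T1: "T = {#1, 1, 1#}"
  shows "G \<cong>\<^sub>G dodecahedron_graph"
proof -
  have one: "npent a b c = 1" if "adj b a" "adj b c" "a \<noteq> c" for a b c
  proof -
    obtain z where n: "nb b a c z" using ex_nb2 \<open>adj b a\<close> \<open>adj b c\<close> \<open>a \<noteq> c\<close> by blast
    have "npent a b c \<in># T" unfolding T[OF n, symmetric] by simp
    then show ?thesis using T1 by simp
  qed
  have uniq: "d = d' \<and> e = e'" if q: "pentagon a b c d e" "pentagon a b c d' e'" for a b c d e d' e'
  proof -
    have "adj a b" "adj b c" "a \<noteq> c" using q(1) pentagon_distinct[OF q(1)] by (auto simp: pentagon_def)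
    then have "npent a b c = 1" using one adj_sym by blast
    then show ?thesis using unique_pentagon[OF _ q] by blast
  qed
  \<comment> \<open>The face on the other side of the edge from \<open>b\<close> to
    \<open>c\<close>: the 5-cycle through \<open>r, b, c\<close> cannot continue to
    \<open>d\<close>, as it would share the 2-path \<open>b, c, d\<close> with the given one, so it
    continues to \<open>s\<close>.\<close>
  have face: "\<exists>w. pentagon r b c s w"
    if q: "pentagon a b c d e" and b: "nb b a c r" and c: "nb c b d s" for a b c d e r s
  proof -
    note B = nb_adj[OF b] nb_distinct[OF b]
    have "npent r b c = 1" using one B by blast
    then obtain y w where y: "pentagon r b c y w" using npent_nonzero_pentagon[of r b c] B adj_sym by auto
    have "adj c y" "y \<noteq> b" using y pentagon_distinct[OF y] by (auto simp: pentagon_def)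
    moreover have "y \<noteq> d"
    proof
      assume "y = d"
      then have "pentagon b c d w r" using pentagon_rotate[OF y] by simp
      then show False using uniq[OF pentagon_rotate[OF q]] B by blast
    qed
    ultimately have "y = s" using nb_adj_iff[OF c, of y] by blast
    then show ?thesis using y by blast
  qed
  \<comment> \<open>Going outwards from one face, the dodecahedron consists of four rings of five vertices
    \<open>u, v, w, x\<close>, indexed by the integers modulo 5.\<close>
  obtain a0 a1 a2 a3 a4 where q: "pentagon a0 a1 a2 a3 a4" using ex_pentagon by blast
  define u :: "5 \<Rightarrow> 'a" where
    "u i = (if i = 0 then a0 else if i = 1 then a1 else if i = 2 then a2 else if i = 3 then a3 else a4)" for i
  have P: "pentagon (u i) (u (i + 1)) (u (i + 2)) (u (i + 3)) (u (i + 4))" for i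
    using cases_5[of i] q unfolding pentagon_def by (elim disjE) (simp_all add: u_def)
  have uu: "u i \<noteq> u (i + 1)" "u i \<noteq> u (i + 2)" "u i \<noteq> u (i + 4)" "u (i + 1) \<noteq> u (i + 4)" for i
    using pentagon_distinct[OF P[of i]] by auto
  then have inj_u: "inj u" by (intro inj_5I)
  have au: "adj (u i) (u (i + 1))" "adj (u i) (u (i + 4))" for i
    using P[of i] adj_sym unfolding pentagon_def by blast+
  have "\<exists>v. nb (u i) (u (i + 1)) (u (i + 4)) v" for i
    using ex_nb2[OF au] uu by blast
  then obtain v where nbu: "nb (u i) (u (i + 1)) (u (i + 4)) (v i)" for i by metis
  have uv: "adj (u i) (v i)" "adj (v i) (u i)" for i using nb_adj[OF nbu] adj_sym by blast+
  have "\<exists>w. pentagon (v i) (u i) (u (i + 1)) (v (i + 1)) w" for i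
  proof (rule face)
    show "pentagon (u (i + 4)) (u i) (u (i + 1)) (u (i + 2)) (u (i + 3))"
      using P[of "i + 4"] by (simp add: add.commute)
    show "nb (u i) (u (i + 4)) (u (i + 1)) (v i)" using nbu[of i] nb_swap nb_rotate by blast
    show "nb (u (i + 1)) (u i) (u (i + 2)) (v (i + 1))"
      using nb_swap[OF nb_rotate[OF nbu[of "i + 1"]]] by (simp add: add.commute)
  qed
  then obtain w where F: "pentagon (v i) (u i) (u (i + 1)) (v (i + 1)) (w i)" for i by metis
  have vw: "adj (v i) (w i)" "adj (w i) (v i)" "adj (v (i + 1)) (w i)" "adj (w i) (v (i + 1))" for i
    using F[of i] adj_sym unfolding pentagon_def by blast+
  have sh: "u (i + 1 + 1) = u (i + 2)" "u (i + 4 + 4) = u (i + 3)" "u (i + 2 + 4) = u (i + 1)"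
    "u (i + 4 + 1) = u i" "u (i + 1 + 4) = u i" for i
    by (simp_all add: add.commute)
  have u_v: "u i \<noteq> v j" for i j
  proof (rule all_shifts_5[where P = "\<lambda>i. u i \<noteq> v j" and i = j])
    show "u j \<noteq> v j" using uv(1)[of j] by auto
    show "u (j + 1) \<noteq> v j" "u (j + 4) \<noteq> v j" using nb_distinct[OF nbu[of j]] by auto
    show "u (j + 2) \<noteq> v j"
      using no_triangle[OF au(1)[of j], of "u (j + 2)"] au(1)[of "j + 1"] uv(2)[of j] sh(1) by metis
    show "u (j + 3) \<noteq> v j"
      using no_triangle[OF au(2)[of j], of "u (j + 3)"] au(2)[of "j + 4"] uv(2)[of j] sh(2) by metis
  qed
  have v_v: "v i \<noteq> v (i + 1)" "v i \<noteq> v (i + 2)" for i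
  proof -
    show "v i \<noteq> v (i + 1)"
      using no_triangle[OF au(1)[of i], of "v i"] uv(1)[of "i + 1"] uv(2)[of i] by metis
    show "v i \<noteq> v (i + 2)"
      using unique_common_neighbour[of "u i" "u (i + 1)" "u (i + 2)" "v i"] au(1)[of i]
        au(2)[of "i + 2"] sh(3) uv(1)[of i] uv(1)[of "i + 2"] uu(2)[of i] u_v by metis
  qed
  then have inj_v: "inj v" by (intro inj_5I)
  have vv1: "\<not> adj (v i) (v (i + 1))" for i
    using no_square[of "v i" "u i" "u (i + 1)" "v (i + 1)"] uv(2)[of i] au(1)[of i] uv(1)[of "i + 1"]
      u_v adj_sym by metis
  have vv2: "\<not> adj (v i) (v (i + 2))" for i
  proof
    assume "adj (v i) (v (i + 2))"
    then have "pentagon (u i) (u (i + 1)) (u (i + 2)) (v (i + 2)) (v i)"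
      using P[of i] uv adj_sym unfolding pentagon_def by blast
    then show False using uniq[OF P[of i]] u_v by blast
  qed
  have not_vv: "\<not> adj (v i) (v j)" for i j
  proof (rule all_shifts_5[where P = "\<lambda>j. \<not> adj (v i) (v j)" and i = i])
    show "\<not> adj (v i) (v (i + 3))" using vv2[of "i + 3"] adj_sym by auto
    show "\<not> adj (v i) (v (i + 4))" using vv1[of "i + 4"] adj_sym by auto
  qed (simp_all add: vv1 vv2)
  have v_w: "v i \<noteq> w j" for i j using vw not_vv by metis
  have u_w: "u i \<noteq> w j" for i j
  proof
    assume "u i = w j"
    then have "v j = v i" "v (j + 1) = v i"
      using nb_adj_iff[OF nbu[of i], of "v j"] nb_adj_iff[OF nbu[of i], of "v (j + 1)"]
        vw(2,4)[of j] u_v by metis+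
    then show False using v_v(1)[of j] by simp
  qed
  \<comment> \<open>Otherwise the faces across the two edges at \<open>u i\<close> of the first
    pentagon would share the 2-path \<open>w i, v i, u i\<close>.\<close>
  have w4: "w (i + 4) \<noteq> w i" for i
  proof
    assume eq: "w (i + 4) = w i"
    have 1: "pentagon (w i) (v i) (u i) (u (i + 1)) (v (i + 1))"
      using F[of i] unfolding pentagon_def by blast
    have "pentagon (w i) (v i) (u i) (u (i + 4)) (v (i + 4))"
      using F[of "i + 4"] eq adj_sym unfolding pentagon_def by simp
    then show False using uniq[OF 1] uu(4)[of i] by blast
  qed
  have nbv: "nb (v i) (u i) (w (i + 4)) (w i)" for i
    using uv(2)[of i] vw(1)[of i] vw(3)[of "i + 4"] u_w w4[of i] by (intro nbI) simp_all
  have w_w: "w i \<noteq> w (i + 1)" "w i \<noteq> w (i + 2)" for i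
  proof -
    show "w i \<noteq> w (i + 1)" using w4[of "i + 1"] by (simp add: add.commute)
    show "w i \<noteq> w (i + 2)"
    proof
      \<comment> \<open>This vertex would have four neighbours in the ring \<open>v\<close>.\<close>
      assume eq: "w i = w (i + 2)"
      have v23: "v i \<noteq> v (i + 2)" "v (i + 1) \<noteq> v (i + 2)" "v (i + 1) \<noteq> v (i + 3)" "v (i + 2) \<noteq> v (i + 3)"
        "v (i + 3) \<noteq> v i"
        using injD[OF inj_v] by fastforce+
      then have "nb (w i) (v i) (v (i + 1)) (v (i + 2))"
        using vw(2,4)[of i] vw(2)[of "i + 2"] eq v_v(1)[of i] by (intro nbI) simp_all
      moreover have "adj (w i) (v (i + 3))" using vw(4)[of "i + 2"] eq by (simp add: add.commute)
      ultimately show False using nb_adj_iff[of "w i" _ _ _ "v (i + 3)"] v23 by metis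
    qed
  qed
  then have inj_w: "inj w" by (intro inj_5I)
  have "\<exists>x. nb (w i) (v i) (v (i + 1)) x" for i using ex_nb2 vw v_v by blast
  then obtain x where nbw: "nb (w i) (v i) (v (i + 1)) (x i)" for i by metis
  \<comment> \<open>The next belt of faces. A fifth vertex \<open>v (i + 2)\<close> would put the
    2-path \<open>v (i + 2), w (i + 1), v (i + 1)\<close> on this face and on one of the previous
    belt.\<close>
  have F2: "pentagon (w (i + 1)) (v (i + 1)) (w i) (x i) (x (i + 1))" for i
  proof -
    have "\<exists>y. pentagon (w (i + 1)) (v (i + 1)) (w i) (x i) y"
    proof (rule face)
      show "pentagon (u (i + 1)) (v (i + 1)) (w i) (v i) (u i)"
        using F[of i] unfolding pentagon_def by blast
      show "nb (v (i + 1)) (u (i + 1)) (w i) (w (i + 1))" using nbv[of "i + 1"] by (simp add: add.commute)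
      show "nb (w i) (v (i + 1)) (v i) (x i)" using nbw[of i] nb_swap nb_rotate by blast
    qed
    then obtain y where y: "pentagon (w (i + 1)) (v (i + 1)) (w i) (x i) y" by blast
    have "y \<noteq> v (i + 1)" "adj (w (i + 1)) y" using pentagon_distinct[OF y] y adj_sym
      unfolding pentagon_def by auto
    moreover have "y \<noteq> v (i + 2)"
    proof
      assume "y = v (i + 2)"
      then have 1: "pentagon (v (i + 2)) (w (i + 1)) (v (i + 1)) (w i) (x i)"
        using y unfolding pentagon_def by blast
      have "pentagon (v (i + 2)) (w (i + 1)) (v (i + 1)) (u (i + 1)) (u (i + 2))"
        using F[of "i + 1"] unfolding pentagon_def by (simp add: add.commute)
      then show False using uniq[OF 1] u_w by metis
    qed
    ultimately have "y = x (i + 1)" using nb_adj_iff[OF nbw[of "i + 1"], of y] by (simp add: add.commute)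
    then show ?thesis using y by simp
  qed
  have ax: "adj (x i) (x (i + 1))" "adj (w i) (x i)" for i
    using F2[of i] nb_adj[OF nbw[of i]] unfolding pentagon_def by blast+
  have x_x: "x i \<noteq> x (i + 1)" "x i \<noteq> x (i + 2)" for i
  proof -
    show "x i \<noteq> x (i + 1)" using ax(1)[of i] by auto
    show "x i \<noteq> x (i + 2)"
    proof
      \<comment> \<open>Two faces of the second belt would then share the 2-path
        \<open>x i, x (i + 1), w (i + 1)\<close>.\<close>
      assume eq: "x i = x (i + 2)"
      have 1: "pentagon (x i) (x (i + 1)) (w (i + 1)) (v (i + 1)) (w i)"
        using F2[of i] unfolding pentagon_def by blast
      have "pentagon (x (i + 2)) (x (i + 1)) (w (i + 1)) (v (i + 2)) (w (i + 2))"
        using F2[of "i + 1"] adj_sym unfolding pentagon_def by (simp add: add.commute)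
      then show False using uniq[OF 1] eq injD[OF inj_v, of "i + 1" "i + 2"] by simp
    qed
  qed
  then have inj_x: "inj x" by (intro inj_5I)
  have v_x: "v i \<noteq> x j" for i j
  proof
    assume eq: "v i = x j"
    then have "w j = w (i + 4) \<or> w j = w i"
      using nb_adj_iff[OF nbv[of i], of "w j"] ax(2)[of j] adj_sym u_w by metis
    then have "i = j + 1 \<or> i = j" using injD[OF inj_w] by fastforce
    then show False using nb_distinct[OF nbw[of j]] eq by auto
  qed
  have u_x: "u i \<noteq> x j" for i j
    using nb_adj_iff[OF nbu[of i], of "w j"] ax(2)[of j] adj_sym u_w v_w by metis
  have ww1: "\<not> adj (w i) (w (i + 1))" for i
    using no_triangle[of "w i" "w (i + 1)" "v (i + 1)"] vw(2)[of "i + 1"] vw(3)[of i] by blast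
  have ww2: "\<not> adj (w i) (w (i + 2))" for i
  proof
    assume a: "adj (w i) (w (i + 2))"
    then have x: "x i = w (i + 2)" "x (i + 2) = w i"
      using nb_adj_iff[OF nbw[of i], of "w (i + 2)"] nb_adj_iff[OF nbw[of "i + 2"], of "w i"]
        v_w adj_sym by metis+
    have "x (i + 1) = x (i + 2)"
      using nb_adj_iff[OF nbw[of "i + 2"], of "x (i + 1)"] ax(1)[of i] x(1) v_x by metis
    then show False using injD[OF inj_x] by fastforce
  qed
  have w_x: "w i \<noteq> x j" for i j
  proof -
    have "\<not> adj (w i) (w j)"
    proof (rule all_shifts_5[where P = "\<lambda>j. \<not> adj (w i) (w j)" and i = i])
      show "\<not> adj (w i) (w (i + 3))" using ww2[of "i + 3"] adj_sym by auto
      show "\<not> adj (w i) (w (i + 4))" using ww1[of "i + 4"] adj_sym by auto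
    qed (simp_all add: ww1 ww2)
    then show ?thesis using ax(2)[of j] adj_sym by metis
  qed
  have nbx: "nb (x i) (w i) (x (i + 1)) (x (i + 4))" for i
    using ax[of i] ax(1)[of "i + 4"] adj_sym w_x injD[OF inj_x, of "i + 1" "i + 4"]
    by (intro nbI) auto
  let ?vs = "[u 0, u 1, u 2, u 3, u 4, v 0, v 1, v 2, v 3, v 4,
    w 0, w 1, w 2, w 3, w 4, x 0, x 1, x 2, x 3, x 4]"
  have inj: "u i = u j \<longleftrightarrow> i = j" "v i = v j \<longleftrightarrow> i = j" "w i = w j \<longleftrightarrow> i = j" "x i = x j \<longleftrightarrow> i = j" for i j
    using inj_u inj_v inj_w inj_x by (auto dest: injD)
  have d: "distinct ?vs" using u_v u_w u_x v_w v_x w_x by (simp add: inj)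
  have "adjacency_list G ?vs dodecahedron_table"
  proof (rule adjacency_listI[OF d])
    show "set ?vs \<subseteq> verts G" using nb_verts[OF nbu] nb_verts[OF nbv] nb_verts[OF nbw] nb_verts[OF nbx] by simp
    have *: "{y. adj (u i) y} = {u (i + 1), u (i + 4), v i}" "{y. adj (v i) y} = {u i, w (i + 4), w i}"
      "{y. adj (w i) y} = {v i, v (i + 1), x i}" "{y. adj (x i) y} = {w i, x (i + 1), x (i + 4)}" for i
      using nbu[of i] nbv[of i] nbw[of i] nbx[of i] unfolding nb_def by blast+
    show "list_all2 (\<lambda>v N. {u. adj v u} = nth ?vs ` set N) ?vs dodecahedron_table"
      by (simp add: dodecahedron_table_def *)
  qed (simp_all add: dodecahedron_table_def)
  then show ?thesis
    by (rule isomorphic_if_same_adjacency_list[OF _ adjacency_list_dodecahedron])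
      (simp add: dodecahedron_table_def)
qed

end

section \<open>Truncations\<close>

context girth_regular_cubic5
begin

text \<open>A vertex of the graph becomes an arc: its matching edge is the underlying edge and its
  5-cycle is the tail. The mate is then the inverse arc, and the two other neighbours are the arcs
  related to it by the scheme.\<close>

lemma isomorphic_truncation:
  assumes T1: "T = {#0, 0, 1#}"
  shows "\<exists>(\<Lambda> :: (nat, nat) multigraph) R. wf_multigraph \<Lambda> \<and> loopless \<Lambda> \<and>
    regular_multigraph 5 \<Lambda> \<and> dihedral_scheme \<Lambda> R \<and> G \<cong>\<^sub>G Tr \<Lambda> R"
proof -
  let ?V = "verts G"
  obtain m where m: "\<And>v. v \<in> verts G \<Longrightarrow> m v \<in> verts G \<and> m (m v) = v \<and> adj v (m v)"
    "\<And>v x y. nb v (m v) x y \<Longrightarrow> npent x v y = 1 \<and> npent (m v) v x = 0 \<and> npent (m v) v y = 0"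
    using T1 by (rule ex_perfect_matching') (simp, blast)
  have mate: "nb b (m b) a c" if "pentagon a b c d e" for a b c d e
    using pentagon_avoids_mate[of m] m that by blast
  define r where "r u w \<longleftrightarrow> adj u w \<and> w \<noteq> m u" for u w
  have r_verts: "u \<in> ?V" "w \<in> ?V" if "r u w" for u w using that adj_verts unfolding r_def by blast+
  have r_sym: "r w u" if "r u w" for u w
    using that adj_sym m(1)[OF r_verts(1)[OF that]] m(1)[OF r_verts(2)[OF that]] unfolding r_def by auto
  have r_nb: "r v w \<longleftrightarrow> w = x \<or> w = y" if "nb v (m v) x y" for v w x y
    using nb_adj_iff[OF that, of w] nb_distinct[OF that] unfolding r_def by blast
  \<comment> \<open>The components of the complement of the matching are the 5-cycles.\<close>
  define K where "K v = {w. r\<^sup>*\<^sup>* v w}" for v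
  have K: "card (K v) = 5 \<and> m v \<notin> K v" if v: "v \<in> ?V" for v
  proof -
    obtain x y where n: "nb v (m v) x y" using ex_nb1 m(1) v by blast
    note N = nb_adj[OF n]
    have "npent x v y \<noteq> 0" using m(2)[OF n] by simp
    then obtain d e where q: "pentagon x v y d e" using npent_nonzero_pentagon[OF _ adj_sym[OF N(2)] N(3)] by blast
    note q1 = pentagon_rotate[OF q] note q2 = pentagon_rotate[OF q1]
    note q3 = pentagon_rotate[OF q2] note q4 = pentagon_rotate[OF q3]
    note R = r_nb[OF mate[OF q]] r_nb[OF mate[OF q1]] r_nb[OF mate[OF q2]] r_nb[OF mate[OF q3]]
      r_nb[OF mate[OF q4]]
    have "w \<in> {x, v, y, d, e}" if "r\<^sup>*\<^sup>* v w" for w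
      using that by (induction rule: rtranclp_induct) (auto simp: R)
    moreover have r: "r v x" "r v y" "r y d" "r x e" using R(1,2,5) by simp_all
    moreover have "r\<^sup>*\<^sup>* v d" "r\<^sup>*\<^sup>* v e"
      using rtranclp.rtrancl_into_rtrancl[OF r_into_rtranclp[of r, OF r(2)] r(3)]
        rtranclp.rtrancl_into_rtrancl[OF r_into_rtranclp[of r, OF r(1)] r(4)] .
    ultimately have K: "K v = {x, v, y, d, e}" unfolding K_def by auto
    \<comment> \<open>A mate on the same 5-cycle would be a chord and close a triangle. This is why
      contraction creates no loops and why all arcs carry the tag \<open>False\<close>.\<close>
    have "m v \<noteq> d" "m v \<noteq> e" using N q no_triangle adj_sym unfolding pentagon_def by metis+
    then show ?thesis using pentagon_distinct[OF q] nb_distinct[OF n] N unfolding K by auto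
  qed
  have rtr_sym: "r\<^sup>*\<^sup>* w v" if "r\<^sup>*\<^sup>* v w" for v w
    using that by (induction rule: rtranclp_induct) (auto intro: converse_rtranclp_into_rtranclp r_sym)
  have K_verts: "K v \<subseteq> ?V" if "v \<in> ?V" for v
  proof
    fix w assume "w \<in> K v"
    then have "r\<^sup>*\<^sup>* v w" by (simp add: K_def)
    then show "w \<in> ?V" by (induction rule: rtranclp_induct) (use that r_verts in auto)
  qed
  have K_eq: "K v = K w \<longleftrightarrow> w \<in> K v" for v w
    unfolding K_def using rtr_sym by (auto intro: rtranclp_trans)
  \<comment> \<open>A single injection of the vertex subsets codes both the contracted 5-cycles and
    the matching edges as natural numbers.\<close>
  have "finite (Pow ?V)" using simple by (simp add: simple_graph_def)
  then obtain g :: "'a set \<Rightarrow> nat" where g: "inj_on g (Pow ?V)"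
    using finite_imp_inj_to_nat_seg by metis
  define \<kappa> where "\<kappa> v = g (K v)" for v
  define \<mu> where "\<mu> v = g {v, m v}" for v
  have \<kappa>: "\<kappa> v = \<kappa> w \<longleftrightarrow> w \<in> K v" if "v \<in> ?V" "w \<in> ?V" for v w
    using that inj_on_eq_iff[OF g, of "K v" "K w"] K_verts K_eq unfolding \<kappa>_def by simp
  have \<mu>: "\<mu> v = \<mu> w \<longleftrightarrow> w = v \<or> w = m v" if vw: "v \<in> ?V" "w \<in> ?V" for v w
    using vw inj_on_eq_iff[OF g, of "{v, m v}" "{w, m w}"] m(1)[OF vw(1)] m(1)[OF vw(2)]
    unfolding \<mu>_def by (auto simp: doubleton_eq_iff)
  define \<Lambda> :: "(nat, nat) multigraph" where
    "\<Lambda> = \<lparr>mverts = \<kappa> ` ?V, medges = \<mu> ` ?V, ends = \<lambda>e. \<kappa> ` {v \<in> ?V. \<mu> v = e}\<rparr>"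
  define F :: "'a \<Rightarrow> (nat, nat) arc" where "F v = Arc (\<mu> v) (\<kappa> v) False" for v
  define R where "R s t \<longleftrightarrow> (\<exists>u w. r u w \<and> s = F u \<and> t = F w)" for s t
  have \<kappa>_mate: "\<kappa> v \<noteq> \<kappa> (m v)" if "v \<in> ?V" for v using that \<kappa> m(1) K by blast
  have ends: "ends \<Lambda> (\<mu> v) = {\<kappa> v, \<kappa> (m v)}" if v: "v \<in> ?V" for v
  proof -
    have "{w \<in> ?V. \<mu> w = \<mu> v} = {v, m v}" using v \<mu>[OF v] m(1)[OF v] by (auto simp: eq_commute)
    then show ?thesis by (simp add: \<Lambda>_def)
  qed
  then have card_ends: "card (ends \<Lambda> (\<mu> v)) = 2" if "v \<in> ?V" for v
    using that \<kappa>_mate by simp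
  have wf: "wf_multigraph \<Lambda>"
  proof -
    have "ends \<Lambda> e \<subseteq> mverts \<Lambda> \<and> ends \<Lambda> e \<noteq> {} \<and> card (ends \<Lambda> e) \<le> 2" if "e \<in> medges \<Lambda>" for e
    proof -
      obtain v where v: "v \<in> ?V" "e = \<mu> v" using \<open>e \<in> medges \<Lambda>\<close> by (auto simp: \<Lambda>_def)
      have "\<kappa> v \<in> mverts \<Lambda>" "\<kappa> (m v) \<in> mverts \<Lambda>" using v m(1) by (simp_all add: \<Lambda>_def)
      then show ?thesis using v ends card_ends by simp
    qed
    moreover have "finite (mverts \<Lambda>)" "finite (medges \<Lambda>)"
      using simple by (simp_all add: \<Lambda>_def simple_graph_def)
    ultimately show ?thesis by (simp add: wf_multigraph_def)
  qed
  have loopless: "loopless \<Lambda>"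
    using card_ends unfolding loopless_def is_loop_def by (auto simp: \<Lambda>_def)
  have F_inj: "F v = F w \<longleftrightarrow> v = w" if "v \<in> ?V" "w \<in> ?V" for v w
    using that \<mu> \<kappa>_mate by (auto simp: F_def)
  have arcs: "arcs \<Lambda> = F ` ?V"
  proof (intro set_eqI iffI)
    fix s assume s: "s \<in> arcs \<Lambda>"
    then obtain v where v: "v \<in> ?V" "arc_edge s = \<mu> v" by (auto simp: arcs_def \<Lambda>_def)
    then have "\<not> arc_tag s" "tail s \<in> {\<kappa> v, \<kappa> (m v)}"
      using s ends card_ends by (auto simp: arcs_def is_loop_def)
    moreover have "\<mu> (m v) = \<mu> v" using \<mu>[of "m v" v] m(1)[OF v(1)] v by simp
    ultimately have "s = F v \<or> s = F (m v)" using v by (cases s) (auto simp: F_def)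
    then show "s \<in> F ` ?V" using v m(1) by blast
  next
    fix s assume "s \<in> F ` ?V"
    then obtain v where "v \<in> ?V" "s = F v" by blast
    then show "s \<in> arcs \<Lambda>" using ends by (auto simp: arcs_def F_def) (simp add: \<Lambda>_def)
  qed
  have out: "out_arcs \<Lambda> (\<kappa> v) = F ` K v" if v: "v \<in> ?V" for v
  proof -
    have "out_arcs \<Lambda> (\<kappa> v) = F ` {w \<in> ?V. \<kappa> w = \<kappa> v}" by (auto simp: out_arcs_def arcs F_def)
    also have "{w \<in> ?V. \<kappa> w = \<kappa> v} = K v" using \<kappa>[OF v] K_verts[OF v] by (auto simp: eq_commute)
    finally show ?thesis .
  qed
  have F_inj_on: "inj_on F ?V" by (rule inj_onI) (simp add: F_inj)
  have regular: "regular_multigraph 5 \<Lambda>"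
    unfolding regular_multigraph_def
  proof
    fix u assume "u \<in> mverts \<Lambda>"
    then obtain v where v: "v \<in> ?V" "u = \<kappa> v" by (auto simp: \<Lambda>_def)
    then show "card (out_arcs \<Lambda> u) = 5"
      using out K K_verts card_image[OF inj_on_subset[OF F_inj_on]] by metis
  qed
  have R_F: "R (F u) (F w) \<longleftrightarrow> r u w" if "u \<in> ?V" "w \<in> ?V" for u w
  proof
    assume "R (F u) (F w)"
    then obtain u' w' where "r u' w'" "F u = F u'" "F w = F w'" by (auto simp: R_def)
    then show "r u w" using that F_inj r_verts by metis
  qed (auto simp: R_def)
  have R_sym: "R t s" if "R s t" for s t using that r_sym unfolding R_def by blast
  let ?S = "scheme_graph \<Lambda> R"
  have adj_S: "adjacent ?S s t \<longleftrightarrow> R s t" for s t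
    using R_sym by (auto simp: adjacent_def scheme_graph_def doubleton_eq_iff)
  have comp: "component_of ?S (F v) = F ` K v" if v: "v \<in> ?V" for v
  proof -
    have "s \<in> F ` K v" if "R\<^sup>*\<^sup>* (F v) s" for s
      using that
    proof (induction rule: rtranclp_induct)
      case base then show ?case by (auto simp: K_def)
    next
      case (step s t)
      then obtain w u u' where w: "w \<in> K v" "s = F w" "r u u'" "s = F u" "t = F u'"
        unfolding R_def by blast
      then have "w = u" using F_inj r_verts K_verts[OF v] by blast
      then show ?case using w by (auto simp: K_def intro: rtranclp.rtrancl_into_rtrancl)
    qed
    moreover have "R\<^sup>*\<^sup>* (F v) (F w)" if "r\<^sup>*\<^sup>* v w" for w
      using that
    proof (induction rule: rtranclp_induct)
      case (step u w)
      then have "R (F u) (F w)" using R_def by blast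
      then show ?case using step by (meson rtranclp.rtrancl_into_rtrancl)
    qed simp
    moreover have "adjacent ?S = R" using adj_S by (intro ext)
    ultimately show ?thesis using arcs K_verts[OF v]
      by (auto simp: component_of_def K_def) (auto simp: scheme_graph_def)
  qed
  have "dihedral_scheme \<Lambda> R"
    unfolding dihedral_scheme_def
  proof (intro conjI)
    show "\<forall>s t. R s t \<longrightarrow> s \<in> arcs \<Lambda> \<and> t \<in> arcs \<Lambda>"
      using r_verts unfolding R_def arcs by blast
    show "irreflp R"
      using F_inj r_verts unfolding irreflp_def R_def r_def by (metis adj_irrefl)
    show "symp R" using R_sym by (auto intro: sympI)
    show "components ?S = out_arcs \<Lambda> ` mverts \<Lambda>"
    proof -
      have "verts ?S = F ` ?V" by (simp add: scheme_graph_def arcs)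
      then show ?thesis unfolding components_def using comp out by (simp add: \<Lambda>_def image_image)
    qed
    show "regular_graph 2 ?S"
      unfolding regular_graph_def
    proof
      fix s assume "s \<in> verts ?S"
      then obtain v where v: "v \<in> ?V" "s = F v" by (auto simp: scheme_graph_def arcs)
      obtain x y where n: "nb v (m v) x y" using ex_nb1 m(1) v by blast
      have xy: "r v x" "r v y" "x \<noteq> y" using r_nb[OF n] nb_distinct[OF n] by auto
      have "e \<in> {{F v, F x}, {F v, F y}}" if e: "e \<in> incident_edges ?S s" for e
      proof -
        obtain a b where ab: "r a b" "e = {F a, F b}" "F v \<in> e"
          using e v by (auto simp: incident_edges_def scheme_graph_def R_def)
        then have "a = v \<or> b = v" using F_inj r_verts v by auto
        then obtain w where "r v w" "e = {F v, F w}" using ab r_sym by (metis insert_commute)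
        then show ?thesis using r_nb[OF n] by auto
      qed
      moreover have "{{F v, F x}, {F v, F y}} \<subseteq> incident_edges ?S s"
        using xy v by (auto simp: incident_edges_def scheme_graph_def R_def)
      ultimately have "incident_edges ?S s = {{F v, F x}, {F v, F y}}" by blast
      moreover have "{F v, F x} \<noteq> {F v, F y}"
        using xy F_inj r_verts by (auto simp: doubleton_eq_iff)
      ultimately show "card (incident_edges ?S s) = 2" by simp
    qed
  qed
  moreover have "G \<cong>\<^sub>G Tr \<Lambda> R"
    unfolding isomorphic_def
  proof (intro exI[of _ F] conjI ballI)
    show "bij_betw F ?V (verts (Tr \<Lambda> R))"
      using F_inj_on by (simp add: bij_betw_def Tr_def arcs)
    fix u w assume uw: "u \<in> ?V" "w \<in> ?V"
    have "adjacent (Tr \<Lambda> R) (F u) (F w) \<longleftrightarrow> R (F u) (F w) \<or> mutually_inverse \<Lambda> (F u) (F w)"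
      using R_sym by (auto simp: adjacent_def Tr_def doubleton_eq_iff mutually_inverse_def)
    also have "mutually_inverse \<Lambda> (F u) (F w) \<longleftrightarrow> \<mu> u = \<mu> w \<and> u \<noteq> w"
      using uw F_inj by (auto simp: mutually_inverse_def arcs F_def)
    also have "\<dots> \<longleftrightarrow> w = m u" using \<mu>[OF uw] m(1)[OF uw(1)] by auto
    also have "R (F u) (F w) \<or> w = m u \<longleftrightarrow> adj u w" using R_F[OF uw] m(1)[OF uw(1)] by (auto simp: r_def)
    finally show "adj u w \<longleftrightarrow> adjacent (Tr \<Lambda> R) (F u) (F w)" by simp
  qed
  ultimately show ?thesis using wf loopless regular by blast
qed

end

section \<open>From the signature to the 2-path counts\<close>

theorem theorem5p1:
  fixes \<Gamma> :: "'a sgraph"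
  assumes "simple_graph \<Gamma>"
    and "connected_graph \<Gamma>"
    and "regular_graph 3 \<Gamma>"
    and "girth_regular \<Gamma>"
    and "girth \<Gamma> = 5"
  shows "(has_signature \<Gamma> [0, 1, 1] \<and>
          (\<exists>(\<Lambda> :: (nat, nat) multigraph) R.
             wf_multigraph \<Lambda> \<and> loopless \<Lambda> \<and> regular_multigraph 5 \<Lambda> \<and>
             dihedral_scheme \<Lambda> R \<and> \<Gamma> \<cong>\<^sub>G Tr \<Lambda> R))
       \<or> \<Gamma> \<cong>\<^sub>G petersen_graph \<or> \<Gamma> \<cong>\<^sub>G dodecahedron_graph"
proof -
  interpret cubic_girth5 \<Gamma> using assms by unfold_locales
  obtain s where s: "\<And>v. v \<in> verts \<Gamma> \<Longrightarrow> signature \<Gamma> v = s"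
    using assms(4) by (auto simp: girth_regular_def has_signature_def)
  obtain v0 where "v0 \<in> verts \<Gamma>" using assms(2) by (auto simp: connected_graph_def)
  then obtain x0 y0 z0 where n0: "nb v0 x0 y0 z0" using ex_nb by blast
  \<comment> \<open>The signature consists of the pairwise sums of the three counts, so half its
    total is their sum, and subtracting an edge count leaves the count of the opposite 2-path. Only
    \<open>s\<close> enters, so \<open>T\<close> is the same at all vertices.\<close>
  define T where "T = image_mset (\<lambda>t. sum_mset (mset s) div 2 - t) (mset s)"
  have T: "{#npent x v y, npent x v z, npent y v z#} = T" if n: "nb v x y z" for v x y z
  proof -
    have s_eq: "mset s = {#npent x v y + npent x v z, npent x v y + npent y v z, npent x v z + npent y v z#}"
      using mset_signature[OF n] s[OF nb_verts[OF n]] by simp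
    have "sum_mset (mset s) div 2 = npent x v y + npent x v z + npent y v z" by (simp add: s_eq)
    then show ?thesis by (simp add: T_def s_eq add_mset_commute)
  qed
  interpret girth_regular_cubic5 \<Gamma> T
    using assms(2) T by unfold_locales
  have sig: "has_signature \<Gamma> [0, 1, 1]" if T1: "T = {#0, 0, 1#}"
    unfolding has_signature_def
  proof (intro conjI ballI)
    show "girth \<Gamma> \<noteq> \<infinity>" using assms(5) by simp
    fix v assume "v \<in> verts \<Gamma>"
    then obtain x y z where n: "nb v x y z" using ex_nb by blast
    let ?a = "npent x v y" and ?b = "npent x v z" and ?c = "npent y v z"
    have "sum_mset T = ?a + ?b + ?c" using T[OF n] by auto
    then have "{#?a + ?b, ?a + ?c, ?b + ?c#} = image_mset (\<lambda>t. sum_mset T - t) T"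
      by (simp add: T[OF n, symmetric] add_mset_commute)
    also have "\<dots> = {#0, 1, 1#}" by (simp add: T1)
    finally have "mset (signature \<Gamma> v) = {#0, 1, 1#}" using mset_signature[OF n] by simp
    then have "signature \<Gamma> v = sorted_list_of_multiset {#0, 1, 1#}"
      unfolding signature_def by simp
    then show "signature \<Gamma> v = [0, 1, 1]" by simp
  qed
  let ?a = "npent x0 v0 y0" and ?b = "npent x0 v0 z0" and ?c = "npent y0 v0 z0"
  have le: "?a \<le> 2" "?b \<le> 2" "?c \<le> 2"
    using npent_le_2 nb_adj[OF n0] nb_distinct[OF n0] adj_sym by blast+
  have "?a \<in> {0, 1, 2}" "?b \<in> {0, 1, 2}" "?c \<in> {0, 1, 2}" using le by auto
  \<comment> \<open>All ten multisets over \<open>{0, 1, 2}\<close>; the alternative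
    \<open>count T 0 = 1\<close> covers three of them.\<close>
  then have "T = {#0, 0, 0#} \<or> T = {#0, 0, 1#} \<or> T = {#0, 0, 2#} \<or> count T 0 = 1 \<or>
      T = {#1, 1, 1#} \<or> T = {#1, 1, 2#} \<or> T = {#2, 2, 1#} \<or> T = {#2, 2, 2#}"
    unfolding T[OF n0, symmetric]
    by (elim insertE emptyE) (simp_all add: add_mset_commute)
  then have "T = {#0, 0, 1#} \<or> T = {#1, 1, 1#} \<or> T = {#2, 2, 2#}"
    using T_ne_0 T_ne_002 count_0_ne_1 T_ne_112 T_ne_122 by blast
  then show ?thesis using sig isomorphic_truncation isomorphic_petersen isomorphic_dodecahedron
    by blast
qed

end
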